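(* Let $A$ be a Lie algebroid. Any Hamiltonian pair on $A$ is a Poisson pair, and, conversely, if $(\pi,\pi')$ is a non-degenerate Poisson pair on $A$, then $(\pi,\pi')$ is a Hamiltonian pair.
   Context: $[~,~]$ denotes the Lie algebroid bracket on $\Gamma A$, and also the Schouten--Nijenhuis bracket on $\Gamma(\wedge^\bullet A)$. A bivector $\pi\in\Gamma(\wedge^2A)$ is identified with the map $\pi:A^*\to A$, $\pi\xi=i_\xi\pi$, i.e. $\langle\eta,\pi\xi\rangle=\pi(\xi,\eta)$, and with the induced map on sections; it is non-degenerate if this bundle map is invertible. It is a Poisson structure (Poisson bivector) if $[\pi,\pi]=0$. A Hamiltonian pair is a pair $(\pi,\pi')$ of Poisson structures such that $\pi+\pi'$ is also a Poisson structure, equivalently $[\pi,\pi']=0$. Relations are taken at the level of sections. For a relation $\mathbf N\subset\Gamma A\times\Gamma A$, the dual relation is $\mathbf N^*=\{(\beta,\alpha)\in\Gamma(A^* )\times\Gamma(A^* )\mid\langle\alpha,u\rangle=\langle\beta,v\rangle\ \forall(u,v)\in\mathbf N\}$. $\mathbf N$ is a Nijenhuis relation if its torsion vanishes, i.e. $\langle\alpha,[v_1,v_2]\rangle-\langle\alpha',[v_1,u_2]+[u_1,v_2]\rangle+\langle\alpha'',[u_1,u_2]\rangle=0$ for all $(u_1,v_1),(u_2,v_2)\in\mathbf N$ and all $(\alpha,\alpha'),(\alpha',\alpha'')\in\mathbf N^*$. For bivectors $\pi,\pi'$, $\mathbf N(\pi,\pi')=\{(\pi'\xi,\pi\xi)\mid\xi\in\Gamma(A^*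 )\}$. A Poisson pair is a pair $(\pi,\pi')$ of Poisson bivectors such that $\mathbf N(\pi,\pi')$ is a Nijenhuis relation; it is a non-degenerate Poisson pair if both bivectors are non-degenerate. *)

theory Defs
  imports "HOL-Analysis.Analysis"
begin

section \<open>Smooth manifolds\<close>

text \<open>\<open>k\<close>-fold continuous differentiability on an open set, via iterated directional
  derivatives.\<close>

fun Ck_on :: "nat \<Rightarrow> 'a::real_normed_vector set \<Rightarrow> ('a \<Rightarrow> 'c::real_normed_vector) \<Rightarrow> bool" where
  "Ck_on 0 S f \<longleftrightarrow> continuous_on S f"
| "Ck_on (Suc k) S f \<longleftrightarrow> (\<forall>x\<in>S. f differentiable (at x)) \<and>
     (\<forall>v. Ck_on k S (\<lambda>x. frechet_derivative f (at x) v))"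

definition Cinf_on :: "'a::real_normed_vector set \<Rightarrow> ('a \<Rightarrow> 'c::real_normed_vector) \<Rightarrow> bool" where
  "Cinf_on S f \<longleftrightarrow> (\<forall>k. Ck_on k S f)"

text \<open>A chart is a pair of a domain and a coordinate map. The manifold is the whole type \<open>'m\<close>,
  and the model space \<open>'b\<close> is any finite-dimensional real inner product space. The class
  \<open>euclidean_space\<close> is not used here since it excludes dimension 0, that is, it would exclude
  Lie algebras regarded as Lie algebroids over a point.\<close>

type_synonym ('m, 'b) chart = "'m set \<times> ('m \<Rightarrow> 'b)"

definition smooth_atlas ::
  "('m::{t2_space,second_countable_topology}, 'b::real_inner) chart set \<Rightarrow> bool" where
  "smooth_atlas C \<longleftrightarrow>
     (\<exists>B::'b set. finite B \<and> span B = UNIV) \<and>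
     (\<forall>x. \<exists>(U, \<phi>)\<in>C. x \<in> U) \<and>
     (\<forall>(U, \<phi>)\<in>C. open U \<and> open (\<phi> ` U) \<and> homeomorphism U (\<phi> ` U) \<phi> (inv_into U \<phi>)) \<and>
     (\<forall>(U, \<phi>)\<in>C. \<forall>(V, \<psi>)\<in>C. Cinf_on (\<phi> ` (U \<inter> V)) (\<psi> \<circ> inv_into U \<phi>))"

definition smooth_fun_on :: "('m, 'b::real_inner) chart set \<Rightarrow> 'm set \<Rightarrow> ('m \<Rightarrow> real) \<Rightarrow> bool" where
  "smooth_fun_on C W f \<longleftrightarrow> (\<forall>(U, \<phi>)\<in>C. Cinf_on (\<phi> ` (U \<inter> W)) (f \<circ> inv_into U \<phi>))"

text \<open>Tangent vectors are derivations at \<open>x\<close> of the algebra of smooth functions; their values on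
  non-smooth functions are irrelevant.\<close>

definition tangent_vector ::
  "('m, 'b::real_inner) chart set \<Rightarrow> 'm \<Rightarrow> (('m \<Rightarrow> real) \<Rightarrow> real) \<Rightarrow> bool" where
  "tangent_vector C x D \<longleftrightarrow>
     (\<forall>f g. smooth_fun_on C UNIV f \<longrightarrow> smooth_fun_on C UNIV g \<longrightarrow>
        D (\<lambda>y. f y + g y) = D f + D g \<and>
        D (\<lambda>y. f y * g y) = f x * D g + g x * D f) \<and>
     (\<forall>c f. smooth_fun_on C UNIV f \<longrightarrow> D (\<lambda>y. c * f y) = c * D f)"

section \<open>Vector bundles and their sections\<close>

text \<open>The fibres are subspaces of one real vector space \<open>'e\<close>, which carries no topology and whose
  dimension is not restricted. This loses no generality: the fibres of any vector bundle embed in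
  the direct sum of all of them. The smooth structure is given by local trivialisations over open
  sets \<open>U\<close>, each represented by the frame \<open>e 0, \<dots>, e (r - 1)\<close> corresponding to the standard
  basis of \<open>\<real>\<^sup>r\<close>. A section is a function \<open>s\<close> with \<open>s x\<close> in the fibre at \<open>x\<close>.\<close>

record ('m, 'b, 'e) vec_bundle =
  atlas :: "('m, 'b) chart set"
  bundle_rank :: nat
  fibre :: "'m \<Rightarrow> 'e set"
  frames :: "('m set \<times> (nat \<Rightarrow> 'm \<Rightarrow> 'e)) set"

text \<open>The \<open>i\<close>-th element of the dual basis of the frame \<open>e\<close> at \<open>x\<close>; as \<open>representation\<close> does,
  it vanishes outside the span of the frame.\<close>

definition coframe ::
  "('m, 'b, 'e::real_vector, 'z) vec_bundle_scheme \<Rightarrow> (nat \<Rightarrow> 'm \<Rightarrow> 'e) \<Rightarrow> nat \<Rightarrow> 'm \<Rightarrow> 'e \<Rightarrow> real" where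
  "coframe A e i x = (\<lambda>v. representation ((\<lambda>j. e j x) ` {..<bundle_rank A}) v (e i x))"

definition vector_bundle ::
  "('m::{t2_space,second_countable_topology}, 'b::real_inner, 'e::real_vector, 'z) vec_bundle_scheme
    \<Rightarrow> bool" where
  "vector_bundle A \<longleftrightarrow>
     smooth_atlas (atlas A) \<and>
     (\<forall>x. \<exists>(U, e)\<in>frames A. x \<in> U) \<and>
     (\<forall>(U, e)\<in>frames A. open U \<and>
        (\<forall>x\<in>U. inj_on (\<lambda>i. e i x) {..<bundle_rank A} \<and>
                independent ((\<lambda>i. e i x) ` {..<bundle_rank A}) \<and>
                span ((\<lambda>i. e i x) ` {..<bundle_rank A}) = fibre A x)) \<and>
     (\<forall>(U, e)\<in>frames A. \<forall>(V, e')\<in>frames A. \<forall>i<bundle_rank A. \<forall>j<bundle_rank A.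
        smooth_fun_on (atlas A) (U \<inter> V) (\<lambda>x. coframe A e i x (e' j x)))"

definition sections ::
  "('m, 'b::real_inner, 'e::real_vector, 'z) vec_bundle_scheme \<Rightarrow> ('m \<Rightarrow> 'e) set" where
  "sections A = {s. (\<forall>x. s x \<in> fibre A x) \<and>
     (\<forall>(U, e)\<in>frames A. \<forall>i<bundle_rank A.
        smooth_fun_on (atlas A) U (\<lambda>x. coframe A e i x (s x)))}"

text \<open>Functionals on a fibre are extended by 0 to all of \<open>'e\<close>, to be determined by their values on
  the fibre.\<close>

definition dual_fibre ::
  "('m, 'b, 'e::real_vector, 'z) vec_bundle_scheme \<Rightarrow> 'm \<Rightarrow> ('e \<Rightarrow> real) set" where
  "dual_fibre A x = {\<xi>.
     (\<forall>u\<in>fibre A x. \<forall>v\<in>fibre A x. \<xi> (u + v) = \<xi> u + \<xi> v) \<and>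
     (\<forall>c. \<forall>u\<in>fibre A x. \<xi> (c *\<^sub>R u) = c * \<xi> u) \<and>
     (\<forall>u. u \<notin> fibre A x \<longrightarrow> \<xi> u = 0)}"

definition dual_sections ::
  "('m, 'b::real_inner, 'e::real_vector, 'z) vec_bundle_scheme \<Rightarrow> ('m \<Rightarrow> 'e \<Rightarrow> real) set" where
  "dual_sections A = {\<xi>. (\<forall>x. \<xi> x \<in> dual_fibre A x) \<and>
     (\<forall>(U, e)\<in>frames A. \<forall>i<bundle_rank A. smooth_fun_on (atlas A) U (\<lambda>x. \<xi> x (e i x)))}"

section \<open>Bivectors\<close>

text \<open>An element of the second exterior power of a fibre is regarded as an alternating bilinear form
  on the dual fibre; its values on other arguments are irrelevant.\<close>

type_synonym ('m, 'e) bivector_field = "'m \<Rightarrow> ('e \<Rightarrow> real) \<Rightarrow> ('e \<Rightarrow> real) \<Rightarrow> real"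

definition bivectors ::
  "('m, 'b::real_inner, 'e::real_vector, 'z) vec_bundle_scheme \<Rightarrow> ('m, 'e) bivector_field set" where
  "bivectors A = {P.
     (\<forall>x. \<forall>\<xi>\<in>dual_fibre A x. P x \<xi> \<xi> = 0 \<and>
        (\<forall>\<eta>\<in>dual_fibre A x.
           (\<forall>\<zeta>\<in>dual_fibre A x.
              P x (\<lambda>u. \<xi> u + \<eta> u) \<zeta> = P x \<xi> \<zeta> + P x \<eta> \<zeta> \<and>
              P x \<zeta> (\<lambda>u. \<xi> u + \<eta> u) = P x \<zeta> \<xi> + P x \<zeta> \<eta>) \<and>
           (\<forall>c. P x (\<lambda>u. c * \<xi> u) \<eta> = c * P x \<xi> \<eta> \<and> P x \<eta> (\<lambda>u. c * \<xi> u) = c * P x \<eta> \<xi>))) \<and>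
     (\<forall>(U, e)\<in>frames A. \<forall>i<bundle_rank A. \<forall>j<bundle_rank A.
        smooth_fun_on (atlas A) U (\<lambda>x. P x (coframe A e i x) (coframe A e j x)))}"

text \<open>The bundle map from the dual bundle given by \<open>\<langle>\<eta>, P \<xi>\<rangle> = P(\<xi>, \<eta>)\<close>.\<close>

definition sharp ::
  "('m, 'b, 'e::real_vector, 'z) vec_bundle_scheme \<Rightarrow> ('m, 'e) bivector_field \<Rightarrow>
    'm \<Rightarrow> ('e \<Rightarrow> real) \<Rightarrow> 'e" where
  "sharp A P x \<xi> = (THE v. v \<in> fibre A x \<and> (\<forall>\<eta>\<in>dual_fibre A x. \<eta> v = P x \<xi> \<eta>))"

definition sharp_section ::
  "('m, 'b, 'e::real_vector, 'z) vec_bundle_scheme \<Rightarrow> ('m, 'e) bivector_field \<Rightarrow>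
    ('m \<Rightarrow> 'e \<Rightarrow> real) \<Rightarrow> 'm \<Rightarrow> 'e" where
  "sharp_section A P \<xi> = (\<lambda>x. sharp A P x (\<xi> x))"

definition nondegenerate ::
  "('m, 'b, 'e::real_vector, 'z) vec_bundle_scheme \<Rightarrow> ('m, 'e) bivector_field \<Rightarrow> bool" where
  "nondegenerate A P \<longleftrightarrow> (\<forall>x. bij_betw (sharp A P x) (dual_fibre A x) (fibre A x))"

definition wedge2 :: "'e \<Rightarrow> 'e \<Rightarrow> ('e \<Rightarrow> real) \<Rightarrow> ('e \<Rightarrow> real) \<Rightarrow> real" where
  "wedge2 u v \<alpha> \<beta> = \<alpha> u * \<beta> v - \<alpha> v * \<beta> u"

definition wedge3 ::
  "'e \<Rightarrow> 'e \<Rightarrow> 'e \<Rightarrow> ('e \<Rightarrow> real) \<Rightarrow> ('e \<Rightarrow> real) \<Rightarrow> ('e \<Rightarrow> real) \<Rightarrow> real" where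
  "wedge3 u v w \<alpha> \<beta> \<gamma> =
     \<alpha> u * (\<beta> v * \<gamma> w - \<beta> w * \<gamma> v) -
     \<alpha> v * (\<beta> u * \<gamma> w - \<beta> w * \<gamma> u) +
     \<alpha> w * (\<beta> u * \<gamma> v - \<beta> v * \<gamma> u)"

section \<open>Lie algebroids\<close>

record ('m, 'b, 'e) lie_algebroid = "('m, 'b, 'e) vec_bundle" +
  bracket :: "('m \<Rightarrow> 'e) \<Rightarrow> ('m \<Rightarrow> 'e) \<Rightarrow> ('m \<Rightarrow> 'e)"
  anchor :: "'m \<Rightarrow> 'e \<Rightarrow> ('m \<Rightarrow> real) \<Rightarrow> real"

definition bundle_map_to_tangent ::
  "('m, 'b::real_inner, 'e::real_vector, 'z) vec_bundle_scheme \<Rightarrow>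
    ('m \<Rightarrow> 'e \<Rightarrow> ('m \<Rightarrow> real) \<Rightarrow> real) \<Rightarrow> bool" where
  "bundle_map_to_tangent A \<rho> \<longleftrightarrow>
     (\<forall>x. \<forall>u\<in>fibre A x. tangent_vector (atlas A) x (\<rho> x u)) \<and>
     (\<forall>x f. smooth_fun_on (atlas A) UNIV f \<longrightarrow>
        (\<forall>u\<in>fibre A x. \<forall>v\<in>fibre A x. \<rho> x (u + v) f = \<rho> x u f + \<rho> x v f) \<and>
        (\<forall>c. \<forall>u\<in>fibre A x. \<rho> x (c *\<^sub>R u) f = c * \<rho> x u f)) \<and>
     (\<forall>u\<in>sections A. \<forall>f. smooth_fun_on (atlas A) UNIV f \<longrightarrow>
        smooth_fun_on (atlas A) UNIV (\<lambda>x. \<rho> x (u x) f))"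

definition lie_bracket_on_sections ::
  "('m, 'b::real_inner, 'e::real_vector, 'z) vec_bundle_scheme \<Rightarrow>
    (('m \<Rightarrow> 'e) \<Rightarrow> ('m \<Rightarrow> 'e) \<Rightarrow> ('m \<Rightarrow> 'e)) \<Rightarrow> bool" where
  "lie_bracket_on_sections A br \<longleftrightarrow>
     (\<forall>u\<in>sections A. \<forall>v\<in>sections A. br u v \<in> sections A) \<and>
     (\<forall>u\<in>sections A. \<forall>v\<in>sections A. \<forall>w\<in>sections A. \<forall>x.
        br (\<lambda>y. u y + v y) w x = br u w x + br v w x \<and>
        br w (\<lambda>y. u y + v y) x = br w u x + br w v x) \<and>
     (\<forall>c. \<forall>u\<in>sections A. \<forall>v\<in>sections A. \<forall>x.
        br (\<lambda>y. c *\<^sub>R u y) v x = c *\<^sub>R br u v x \<and>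
        br u (\<lambda>y. c *\<^sub>R v y) x = c *\<^sub>R br u v x) \<and>
     (\<forall>u\<in>sections A. \<forall>x. br u u x = 0) \<and>
     (\<forall>u\<in>sections A. \<forall>v\<in>sections A. \<forall>w\<in>sections A. \<forall>x.
        br u (br v w) x + br v (br w u) x + br w (br u v) x = 0)"

text \<open>That the anchor is a homomorphism of Lie algebras on sections follows from these axioms.\<close>

definition is_lie_algebroid ::
  "('m::{t2_space,second_countable_topology}, 'b::real_inner, 'e::real_vector, 'z) lie_algebroid_scheme
    \<Rightarrow> bool" where
  "is_lie_algebroid A \<longleftrightarrow>
     vector_bundle A \<and>
     lie_bracket_on_sections A (bracket A) \<and>
     bundle_map_to_tangent A (anchor A) \<and>
     (\<forall>u\<in>sections A. \<forall>v\<in>sections A. \<forall>f. smooth_fun_on (atlas A) UNIV f \<longrightarrow>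
        (\<forall>x. bracket A u (\<lambda>y. f y *\<^sub>R v y) x =
             f x *\<^sub>R bracket A u v x + anchor A x (u x) f *\<^sub>R v x))"

section \<open>Schouten--Nijenhuis bracket and Poisson structures\<close>

text \<open>\<open>[X \<and> Y, Z \<and> W] = [X,Z] \<and> Y \<and> W - [X,W] \<and> Y \<and> Z - [Y,Z] \<and> X \<and> W + [Y,W] \<and> X \<and> Z\<close>,
  from the graded Leibniz rule.\<close>

definition schouten_decomposable ::
  "('m, 'b, 'e::real_vector, 'z) lie_algebroid_scheme \<Rightarrow>
    ('m \<Rightarrow> 'e) \<Rightarrow> ('m \<Rightarrow> 'e) \<Rightarrow> ('m \<Rightarrow> 'e) \<Rightarrow> ('m \<Rightarrow> 'e) \<Rightarrow>
    'm \<Rightarrow> ('e \<Rightarrow> real) \<Rightarrow> ('e \<Rightarrow> real) \<Rightarrow> ('e \<Rightarrow> real) \<Rightarrow> real" where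
  "schouten_decomposable A X Y Z W x \<alpha> \<beta> \<gamma> =
       wedge3 (bracket A X Z x) (Y x) (W x) \<alpha> \<beta> \<gamma>
     - wedge3 (bracket A X W x) (Y x) (Z x) \<alpha> \<beta> \<gamma>
     - wedge3 (bracket A Y Z x) (X x) (W x) \<alpha> \<beta> \<gamma>
     + wedge3 (bracket A Y W x) (X x) (Z x) \<alpha> \<beta> \<gamma>"

definition decomposes_on ::
  "('m, 'b::real_inner, 'e::real_vector, 'z) vec_bundle_scheme \<Rightarrow> 'm set \<Rightarrow>
    ('m, 'e) bivector_field \<Rightarrow> (('m \<Rightarrow> 'e) \<times> ('m \<Rightarrow> 'e)) list \<Rightarrow> bool" where
  "decomposes_on A U P ps \<longleftrightarrow> set ps \<subseteq> sections A \<times> sections A \<and>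
     (\<forall>y\<in>U. \<forall>\<xi>\<in>dual_fibre A y. \<forall>\<eta>\<in>dual_fibre A y.
        P y \<xi> \<eta> = (\<Sum>(X, Y)\<leftarrow>ps. wedge2 (X y) (Y y) \<xi> \<eta>))"

text \<open>Every bivector is, near each point, a finite sum of wedge products of global sections (a local
  frame is cut off by a bump function). Since the bracket is local, its trivector value at \<open>x\<close>, an
  alternating trilinear form on the dual fibre, is obtained by biadditivity from any such
  decompositions.\<close>

definition schouten ::
  "('m::topological_space, 'b::real_inner, 'e::real_vector, 'z) lie_algebroid_scheme \<Rightarrow>
    ('m, 'e) bivector_field \<Rightarrow> ('m, 'e) bivector_field \<Rightarrow>
    'm \<Rightarrow> ('e \<Rightarrow> real) \<Rightarrow> ('e \<Rightarrow> real) \<Rightarrow> ('e \<Rightarrow> real) \<Rightarrow> real" where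
  "schouten A P Q x \<alpha> \<beta> \<gamma> = (THE r. \<exists>U ps qs. open U \<and> x \<in> U \<and>
     decomposes_on A U P ps \<and> decomposes_on A U Q qs \<and>
     r = (\<Sum>(X, Y)\<leftarrow>ps. \<Sum>(Z, W)\<leftarrow>qs. schouten_decomposable A X Y Z W x \<alpha> \<beta> \<gamma>))"

definition poisson_bivector ::
  "('m::topological_space, 'b::real_inner, 'e::real_vector, 'z) lie_algebroid_scheme \<Rightarrow>
    ('m, 'e) bivector_field \<Rightarrow> bool" where
  "poisson_bivector A P \<longleftrightarrow> P \<in> bivectors A \<and>
     (\<forall>x. \<forall>\<alpha>\<in>dual_fibre A x. \<forall>\<beta>\<in>dual_fibre A x. \<forall>\<gamma>\<in>dual_fibre A x. schouten A P P x \<alpha> \<beta> \<gamma> = 0)"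

definition hamiltonian_pair ::
  "('m::topological_space, 'b::real_inner, 'e::real_vector, 'z) lie_algebroid_scheme \<Rightarrow>
    ('m, 'e) bivector_field \<Rightarrow> ('m, 'e) bivector_field \<Rightarrow> bool" where
  "hamiltonian_pair A P P' \<longleftrightarrow> poisson_bivector A P \<and> poisson_bivector A P' \<and>
     poisson_bivector A (\<lambda>x \<xi> \<eta>. P x \<xi> \<eta> + P' x \<xi> \<eta>)"

section \<open>Nijenhuis relations and Poisson pairs\<close>

definition dual_relation ::
  "('m, 'b::real_inner, 'e::real_vector, 'z) vec_bundle_scheme \<Rightarrow>
    ('m \<Rightarrow> 'e) rel \<Rightarrow> ('m \<Rightarrow> 'e \<Rightarrow> real) rel" where
  "dual_relation A N = {(\<beta>, \<alpha>). \<beta> \<in> dual_sections A \<and> \<alpha> \<in> dual_sections A \<and>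
     (\<forall>(u, v)\<in>N. \<forall>x. \<alpha> x (u x) = \<beta> x (v x))}"

definition nijenhuis_relation ::
  "('m, 'b::real_inner, 'e::real_vector, 'z) lie_algebroid_scheme \<Rightarrow> ('m \<Rightarrow> 'e) rel \<Rightarrow> bool" where
  "nijenhuis_relation A N \<longleftrightarrow> N \<subseteq> sections A \<times> sections A \<and>
     (\<forall>u\<^sub>1 v\<^sub>1 u\<^sub>2 v\<^sub>2 \<alpha> \<alpha>' \<alpha>''.
        (u\<^sub>1, v\<^sub>1) \<in> N \<longrightarrow> (u\<^sub>2, v\<^sub>2) \<in> N \<longrightarrow>
        (\<alpha>, \<alpha>') \<in> dual_relation A N \<longrightarrow> (\<alpha>', \<alpha>'') \<in> dual_relation A N \<longrightarrow>
        (\<forall>x. \<alpha> x (bracket A v\<^sub>1 v\<^sub>2 x) - \<alpha>' x (bracket A v\<^sub>1 u\<^sub>2 x + bracket A u\<^sub>1 v\<^sub>2 x)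
             + \<alpha>'' x (bracket A u\<^sub>1 u\<^sub>2 x) = 0))"

definition pair_relation ::
  "('m, 'b::real_inner, 'e::real_vector, 'z) vec_bundle_scheme \<Rightarrow>
    ('m, 'e) bivector_field \<Rightarrow> ('m, 'e) bivector_field \<Rightarrow> ('m \<Rightarrow> 'e) rel" where
  "pair_relation A P P' = {(sharp_section A P' \<xi>, sharp_section A P \<xi>) |\<xi>. \<xi> \<in> dual_sections A}"

definition poisson_pair ::
  "('m::topological_space, 'b::real_inner, 'e::real_vector, 'z) lie_algebroid_scheme \<Rightarrow>
    ('m, 'e) bivector_field \<Rightarrow> ('m, 'e) bivector_field \<Rightarrow> bool" where
  "poisson_pair A P P' \<longleftrightarrow> poisson_bivector A P \<and> poisson_bivector A P' \<and>
     nijenhuis_relation A (pair_relation A P P')"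

definition nondegenerate_poisson_pair ::
  "('m::topological_space, 'b::real_inner, 'e::real_vector, 'z) lie_algebroid_scheme \<Rightarrow>
    ('m, 'e) bivector_field \<Rightarrow> ('m, 'e) bivector_field \<Rightarrow> bool" where
  "nondegenerate_poisson_pair A P P' \<longleftrightarrow>
     poisson_pair A P P' \<and> nondegenerate A P \<and> nondegenerate A P'"

end

theory Submission
  imports "Jordan_Normal_Form.Determinant" Defs
begin

text \<open>Writing \<open>p\<close>, \<open>q\<close> for the maps on sections induced by bivectors \<open>P\<close>, \<open>Q\<close>, one has
  \<open>[P, Q](\<xi>, \<eta>, \<zeta>) = \<zeta>([p \<xi>, q \<eta>] + [q \<xi>, p \<eta>]) - p \<xi> (Q(\<eta>, \<zeta>)) - q \<xi> (P(\<eta>, \<zeta>)) + cyclic\<close>,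
  where the derivatives are taken along the anchor. If \<open>P \<alpha> = P' \<alpha>'\<close> and \<open>P \<alpha>' = P' \<alpha>''\<close>, this turns the
  torsion of \<open>\<bold>N(P, P')\<close> at \<open>\<xi>\<close>, \<open>\<eta>\<close>, \<open>\<alpha>\<close>, \<open>\<alpha>'\<close>, \<open>\<alpha>''\<close> into
  \<open>[P, P](\<xi>, \<eta>, \<alpha>) / 2 + [P', P'](\<xi>, \<eta>, \<alpha>'') / 2 - [P, P'](\<xi>, \<eta>, \<alpha>')\<close>. For Poisson \<open>P\<close>, \<open>P'\<close> it is thus
  \<open>- [P, P'](\<xi>, \<eta>, \<alpha>')\<close>, and in the non-degenerate case \<open>\<alpha>'\<close> has arbitrary values at a given point.\<close>

section \<open>Smooth functions on open sets of the model space\<close>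

text \<open>\<open>schouten\<close> is a definite description over local decompositions into wedge
  products of global sections, so nothing can be read off it before all decompositions are known to
  give one value. The cyclic formula settles this: it mentions no decomposition, is additive and
  local in each of the two maps, and on wedge products it reduces to
  \<open>schouten_decomposable\<close>. It takes sections where \<open>schouten\<close> takes
  covectors at a point, and the relations also consist of sections; bump functions bridge this gap,
  in a model space known only to be spanned by a finite set. The halves in the torsion identity
  appear because for equal bivectors every term of the cyclic formula occurs twice. The dual
  relation enters in two forms: as an equality of pairings it matches the differentiated functions,
  and, after skew-symmetry, as \<open>P \<alpha> = P' \<alpha>'\<close> it matches the brackets. In
  the converse \<open>\<alpha>'\<close> cannot simply be prescribed: \<open>\<alpha>\<close> and
  \<open>\<alpha>''\<close> must exist as smooth global sections, which is where invertibility of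
  both bivectors is used.\<close>

lemma Ck_on_subset:
  "Ck_on k S f \<Longrightarrow> T \<subseteq> S \<Longrightarrow> Ck_on k T f"
  by (induction k arbitrary: f) (auto intro: continuous_on_subset)

lemma Ck_on_SucD:
  assumes "Ck_on (Suc k) S f" "x \<in> S"
  shows "(f has_derivative frechet_derivative f (at x)) (at x)"
  using assms by (simp add: frechet_derivative_works[symmetric])

lemma Ck_on_cong:
  assumes "open S" "\<And>x. x \<in> S \<Longrightarrow> f x = g x" "Ck_on k S f"
  shows "Ck_on k S g"
  using assms(2,3)
proof (induction k arbitrary: f g)
  case 0
  then show ?case using continuous_on_cong by fastforce
next
  case (Suc k)
  have D: "(g has_derivative frechet_derivative f (at x)) (at x)" if "x \<in> S" for x
    using has_derivative_transform_within_open[OF Ck_on_SucD[OF Suc.prems(2) that] \<open>open S\<close> that]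
      Suc.prems(1) by blast
  have "Ck_on k S (\<lambda>x. frechet_derivative g (at x) v)" for v
  proof (rule Suc.IH)
    show "frechet_derivative f (at x) v = frechet_derivative g (at x) v" if "x \<in> S" for x
      using frechet_derivative_at[OF D[OF that]] by simp
    show "Ck_on k S (\<lambda>x. frechet_derivative f (at x) v)" using Suc.prems(2) by simp
  qed
  then show ?case using D by (auto simp: differentiable_def)
qed

text \<open>\<open>Ck_on\<close> refers to the chosen \<open>frechet_derivative\<close>. Uniqueness
  of derivatives lets an explicit formula \<open>D\<close> take its place, which is how the closure
  properties below are proved.\<close>

lemma Ck_on_SucI:
  assumes "open S" "\<And>x. x \<in> S \<Longrightarrow> (f has_derivative D x) (at x)"
    and "\<And>v. Ck_on k S (\<lambda>x. D x v)"
  shows "Ck_on (Suc k) S f"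
proof -
  have "Ck_on k S (\<lambda>x. frechet_derivative f (at x) v)" for v
    by (rule Ck_on_cong[OF assms(1) _ assms(3)[of v]]) (simp add: frechet_derivative_at[OF assms(2), symmetric])
  then show ?thesis using assms(2) by (auto simp: differentiable_def)
qed

text \<open>All derivatives are taken \<open>at x\<close>, so every clause of \<open>Ck_on\<close>
  concerns small open neighbourhoods of single points.\<close>

lemma Ck_on_local:
  assumes "\<And>x. x \<in> S \<Longrightarrow> \<exists>T. open T \<and> x \<in> T \<and> Ck_on k T f"
  shows "Ck_on k S f"
  using assms
proof (induction k arbitrary: f)
  case 0
  then show ?case
    by (auto intro!: continuous_at_imp_continuous_on)
      (meson continuous_on_eq_continuous_at)
next
  case (Suc k)
  have "f differentiable (at x)" if "x \<in> S" for x
    using Suc.prems[OF that] by auto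
  moreover have "Ck_on k S (\<lambda>x. frechet_derivative f (at x) v)" for v
    using Suc.prems by (intro Suc.IH) (metis Ck_on.simps(2))
  ultimately show ?case by simp
qed

text \<open>Serves the product, inverse and chain rules, whose derivatives still contain
  undifferentiated functions.\<close>

lemma Ck_on_lower:
  "Ck_on (Suc k) S f \<Longrightarrow> Ck_on k S f"
proof (induction k arbitrary: f)
  case 0
  then show ?case
    by (auto intro!: continuous_at_imp_continuous_on differentiable_imp_continuous_within)
next
  case (Suc k)
  have "Ck_on k S (\<lambda>x. frechet_derivative f (at x) v)" for v
    using Suc.prems by (intro Suc.IH) simp
  then show ?case using Suc.prems by simp
qed

lemma Ck_on_const: "Ck_on k S (\<lambda>x. c)"
  by (induction k arbitrary: c) (auto simp: frechet_derivative_const)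

lemma Ck_on_bounded_linear_compose:
  assumes "bounded_linear h" "open S" "Ck_on k S f"
  shows "Ck_on k S (\<lambda>x. h (f x))"
  using assms(3)
proof (induction k arbitrary: f)
  case 0
  then show ?case
    by (simp add: bounded_linear.continuous_on[OF assms(1)])
next
  case (Suc k)
  show ?case
  proof (rule Ck_on_SucI[OF \<open>open S\<close>])
    show "((\<lambda>x. h (f x)) has_derivative (\<lambda>v. h (frechet_derivative f (at x) v))) (at x)"
      if "x \<in> S" for x
      using bounded_linear.has_derivative[OF assms(1) Ck_on_SucD[OF Suc.prems that]] .
    show "Ck_on k S (\<lambda>x. h (frechet_derivative f (at x) v))" for v
      using Suc by simp
  qed
qed

lemma Ck_on_bounded_linear:
  assumes "bounded_linear h" "open S"
  shows "Ck_on k S h"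
proof (cases k)
  case 0
  then show ?thesis
    by (simp add: bounded_linear.continuous_on[OF assms(1)])
next
  case (Suc k)
  show ?thesis unfolding Suc
    by (rule Ck_on_SucI[OF \<open>open S\<close> bounded_linear_imp_has_derivative[OF assms(1)] Ck_on_const])
qed

lemma Ck_on_add:
  assumes "open S" "Ck_on k S f" "Ck_on k S g"
  shows "Ck_on k S (\<lambda>x. f x + g x)"
  using assms(2,3)
proof (induction k arbitrary: f g)
  case 0
  then show ?case by (simp add: continuous_on_add)
next
  case (Suc k)
  show ?case
    by (rule Ck_on_SucI[OF \<open>open S\<close>
      has_derivative_add[OF Ck_on_SucD[OF Suc.prems(1)] Ck_on_SucD[OF Suc.prems(2)]]])
      (use Suc in auto)
qed

lemma Ck_on_sum:
  assumes "open S" "\<And>i. i \<in> I \<Longrightarrow> Ck_on k S (f i)"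
  shows "Ck_on k S (\<lambda>x. \<Sum>i\<in>I. f i x)"
  using assms(2) by (induction I rule: infinite_finite_induct) (auto intro: Ck_on_const Ck_on_add[OF assms(1)])

lemma Ck_on_mult:
  fixes f g :: "'a::real_normed_vector \<Rightarrow> real"
  assumes "open S" "Ck_on k S f" "Ck_on k S g"
  shows "Ck_on k S (\<lambda>x. f x * g x)"
  using assms(2,3)
proof (induction k arbitrary: f g)
  case 0
  then show ?case by (simp add: continuous_on_mult)
next
  case (Suc k)
  have "Ck_on k S (\<lambda>x. f x * frechet_derivative g (at x) v + frechet_derivative f (at x) v * g x)" for v
    using Suc.prems by (intro Ck_on_add[OF assms(1)] Suc.IH) (auto dest: Ck_on_lower simp del: Ck_on.simps(2), auto)
  from Ck_on_SucI[OF \<open>open S\<close> has_derivative_mult[OF Ck_on_SucD[OF Suc.prems(1)]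
      Ck_on_SucD[OF Suc.prems(2)]] this]
  show ?case by blast
qed

lemma Ck_on_inverse:
  fixes f :: "'a::real_normed_vector \<Rightarrow> real"
  assumes "open S" "Ck_on k S f" "\<And>x. x \<in> S \<Longrightarrow> f x \<noteq> 0"
  shows "Ck_on k S (\<lambda>x. inverse (f x))"
  using assms(2)
proof (induction k)
  case 0
  then show ?case using assms(3) by (simp add: continuous_on_inverse)
next
  case (Suc k)
  \<comment> \<open>The derivative of \<open>inverse (f x)\<close> contains
    \<open>inverse (f x)\<close> again, but only one order less of it is required.\<close>
  have I: "Ck_on k S (\<lambda>x. inverse (f x))" using Suc Ck_on_lower by blast
  show ?case
  proof (rule Ck_on_SucI[OF \<open>open S\<close>])
    show "((\<lambda>x. inverse (f x)) has_derivative
        (\<lambda>v. (- 1) * (inverse (f x) * frechet_derivative f (at x) v * inverse (f x)))) (at x)"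
      if "x \<in> S" for x
      using Deriv.has_derivative_inverse[OF assms(3)[OF that] Ck_on_SucD[OF Suc.prems that]] by simp
    show "Ck_on k S (\<lambda>x. (- 1) * (inverse (f x) * frechet_derivative f (at x) v * inverse (f x)))" for v
      using Suc.prems by (intro Ck_on_mult[OF assms(1)] Ck_on_const I) simp
  qed
qed

lemma Ck_on_norm_square: "Ck_on k UNIV (\<lambda>z::'b::real_inner. inner (z - z0) (z - z0))"
proof (cases k)
  case 0
  then show ?thesis by (auto intro!: continuous_intros)
next
  case (Suc k)
  show ?thesis unfolding Suc
  proof (rule Ck_on_SucI[OF open_UNIV])
    \<comment> \<open>For fixed \<open>v\<close> this form is a bounded linear function of
      \<open>z\<close> plus a constant, hence smooth to every order without induction.\<close>
    show "((\<lambda>z. inner (z - z0) (z - z0)) has_derivative (\<lambda>v. inner (2 *\<^sub>R v) z + (- 2) * inner v z0)) (at z)" for z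
      by (auto intro!: derivative_eq_intros simp: inner_diff_left inner_diff_right inner_commute algebra_simps)
    show "Ck_on k UNIV (\<lambda>z. inner (2 *\<^sub>R v) z + (- 2) * inner v z0)" for v
      by (intro Ck_on_add Ck_on_const Ck_on_bounded_linear bounded_linear_inner_right open_UNIV)
  qed
qed

text \<open>Coordinates for a space without a fixed \<open>Basis\<close>: after orthogonalising
  \<open>B\<close>, the coefficient at \<open>b\<close> is the projection onto \<open>b\<close>. The
  remainder is orthogonal to \<open>C\<close> and lies in its span, so it is orthogonal to itself. A
  zero vector in \<open>C\<close> does no harm because \<open>1 / 0 = 0\<close>.\<close>

lemma finite_coordinates:
  assumes "finite B" "span B = (UNIV :: 'b::real_inner set)"
  obtains C c where "finite C" "\<And>v::'b. v = (\<Sum>b\<in>C. inner v (c b) *\<^sub>R b)"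
proof -
  obtain C where C: "finite C" "span C = span B" "pairwise orthogonal C"
    using basis_orthogonal[OF assms(1)] by blast
  have "v = (\<Sum>b\<in>C. inner v ((1 / inner b b) *\<^sub>R b) *\<^sub>R b)" for v :: 'b
  proof -
    define w where "w = v - (\<Sum>b\<in>C. inner v ((1 / inner b b) *\<^sub>R b) *\<^sub>R b)"
    have "orthogonal w b" if "b \<in> C" for b
    proof -
      have "inner (\<Sum>b\<in>C. inner v ((1 / inner b b) *\<^sub>R b) *\<^sub>R b) b
          = (\<Sum>d\<in>C. if d = b then inner v b else 0)"
        unfolding inner_sum_left
        by (rule sum.cong) (use C(3) that in \<open>auto simp: pairwise_def orthogonal_def\<close>)
      then show ?thesis using C(1) that by (simp add: w_def orthogonal_def inner_diff_left)
    qed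
    moreover have "w \<in> span C" using assms(2) C(2) by simp
    ultimately have "orthogonal w w" using orthogonal_to_span by blast
    then show ?thesis by (simp add: orthogonal_def w_def)
  qed
  then show thesis by (rule that[OF C(1)])
qed

text \<open>\<open>Ck_on\<close> controls the derivative of \<open>g\<close> only in fixed
  directions, whereas the chain rule applies it to the varying vector
  \<open>frechet_derivative T (at x) v\<close>. Expanding that vector over the finite set
  \<open>C\<close> gives products of functions of lower order.\<close>

lemma Ck_on_compose:
  fixes g :: "'b::real_inner \<Rightarrow> real" and T :: "'a::real_normed_vector \<Rightarrow> 'b"
  assumes B: "finite B" "span B = (UNIV :: 'b set)"
    and S: "open S" "T ` S \<subseteq> S'" and T: "Ck_on k S T" and g: "Ck_on k S' g"
  shows "Ck_on k S (\<lambda>x. g (T x))"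
proof -
  obtain C c where C: "finite C" "\<And>v::'b. v = (\<Sum>b\<in>C. inner v (c b) *\<^sub>R b)"
    using finite_coordinates[OF B] by blast
  show ?thesis using T g
  proof (induction k arbitrary: g)
    case 0
    then show ?case using S by (auto intro: continuous_on_compose2)
  next
    case (Suc k)
    show ?case
    proof (rule Ck_on_SucI[OF S(1)])
      fix x assume "x \<in> S"
      define L where "L = frechet_derivative g (at (T x))"
      have L: "(g has_derivative L) (at (T x))"
        unfolding L_def using \<open>x \<in> S\<close> S Suc.prems(2) by (intro Ck_on_SucD) auto
      have expand: "L v = (\<Sum>b\<in>C. inner v (c b) * L b)" for v
        by (subst C(2)[of v]) (simp add: linear_sum[OF has_derivative_linear[OF L]]
            linear_cmul[OF has_derivative_linear[OF L]] del: inner_scaleR_right)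
      have "((\<lambda>x. g (T x)) has_derivative (\<lambda>v. L (frechet_derivative T (at x) v))) (at x)"
        using has_derivative_compose[OF Ck_on_SucD[OF Suc.prems(1) \<open>x \<in> S\<close>] L] .
      moreover have "(\<lambda>v. L (frechet_derivative T (at x) v))
          = (\<lambda>v. \<Sum>b\<in>C. inner (frechet_derivative T (at x) v) (c b) * L b)"
        by (intro ext expand)
      ultimately have "((\<lambda>x. g (T x)) has_derivative
          (\<lambda>v. \<Sum>b\<in>C. inner (frechet_derivative T (at x) v) (c b) * L b)) (at x)"
        by (simp only:)
      then show "((\<lambda>x. g (T x)) has_derivative
          (\<lambda>v. \<Sum>b\<in>C. inner (frechet_derivative T (at x) v) (c b) * frechet_derivative g (at (T x)) b)) (at x)"
        unfolding L_def .
    next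
      fix v
      have "Ck_on k S (\<lambda>x. inner (frechet_derivative T (at x) v) (c b))" for b
        using Suc.prems(1) by (intro Ck_on_bounded_linear_compose[OF bounded_linear_inner_left S(1)]) simp
      moreover have "Ck_on k S (\<lambda>x. frechet_derivative g (at (T x)) b)" for b
        by (rule Suc.IH) (use Suc.prems Ck_on_lower in auto)
      ultimately show "Ck_on k S (\<lambda>x. \<Sum>b\<in>C. inner (frechet_derivative T (at x) v) (c b) *
          frechet_derivative g (at (T x)) b)"
        by (intro Ck_on_sum Ck_on_mult S(1))
    qed
  qed
qed

text \<open>The flat function \<open>exp (- 1 / t)\<close> together with its multiples by powers of
  \<open>1 / t\<close>: derivatives are combinations of members of this family, so smoothness of all
  members is one induction.\<close>

definition flat_exp :: "nat \<Rightarrow> real \<Rightarrow> real" where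
  "flat_exp n t = (if t > 0 then (1 / t) ^ n * exp (- 1 / t) else 0)"

text \<open>Substituting \<open>s = 1 / t\<close> leaves the limit of \<open>s ^ n / exp s\<close>
  at infinity.\<close>

lemma flat_exp_tendsto: "(flat_exp n \<longlongrightarrow> 0) (at_right 0)"
proof -
  have "((\<lambda>s::real. s ^ n / exp s) \<longlongrightarrow> 0) at_top"
    by (rule tendsto_power_div_exp_0)
  then have "((\<lambda>t::real. inverse t ^ n / exp (inverse t)) \<longlongrightarrow> 0) (at_right 0)"
    using filterlim_compose filterlim_inverse_at_top_right by blast
  then show ?thesis
    by (rule Lim_transform_eventually)
      (auto simp: flat_exp_def eventually_at_right_field exp_minus field_simps intro!: exI[of _ 1])
qed

lemma flat_exp_deriv:
  "(flat_exp n has_real_derivative flat_exp (n + 2) t - n * flat_exp (n + 1) t) (at t)"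
proof -
  consider "t > 0" | "t < 0" | "t = 0" by linarith
  then show ?thesis
  proof cases
    case 1
    have "((\<lambda>t. (1 / t) ^ n * exp (- 1 / t)) has_real_derivative
        flat_exp (n + 2) t - n * flat_exp (n + 1) t) (at t)"
      using 1 by (cases n) (auto intro!: derivative_eq_intros
          simp: flat_exp_def field_simps power_add power2_eq_square,
          metis One_nat_def Suc_pred neq0_conv power_Suc)
    then show ?thesis
      by (rule has_field_derivative_transform_within_open[of _ _ _ "{0<..}"])
        (use 1 in \<open>auto simp: flat_exp_def\<close>)
  next
    case 2
    have "((\<lambda>t. 0) has_real_derivative flat_exp (n + 2) t - n * flat_exp (n + 1) t) (at t)"
      using 2 by (auto simp: flat_exp_def)
    then show ?thesis
      by (rule has_field_derivative_transform_within_open[of _ _ _ "{..<0}"])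
        (use 2 in \<open>auto simp: flat_exp_def\<close>)
  next
    case 3
    \<comment> \<open>At the gluing point the difference quotient is again in the family: for
      \<open>h > 0\<close> it equals \<open>flat_exp (Suc n) h\<close>, and for \<open>h < 0\<close>
      it is 0.\<close>
    have "((\<lambda>h. flat_exp n h / h) \<longlongrightarrow> 0) (at_right 0)"
      by (rule Lim_transform_eventually[OF flat_exp_tendsto[of "Suc n"]])
        (auto simp: flat_exp_def eventually_at_right_field intro!: exI[of _ 1])
    moreover have "((\<lambda>h. flat_exp n h / h) \<longlongrightarrow> 0) (at_left 0)"
      by (rule Lim_transform_eventually[OF tendsto_const])
        (auto simp: flat_exp_def eventually_at_left_field intro!: exI[of _ "-1"])
    ultimately have "((\<lambda>h. flat_exp n h / h) \<longlongrightarrow> 0) (at 0)"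
      by (simp add: filterlim_split_at)
    then show ?thesis using 3 by (simp add: DERIV_def flat_exp_def)
  qed
qed

lemma Ck_on_flat_exp: "Ck_on k UNIV (flat_exp n)"
proof (induction k arbitrary: n)
  case 0
  then show ?case
    by (auto intro!: continuous_at_imp_continuous_on DERIV_isCont[OF flat_exp_deriv])
next
  case (Suc k)
  show ?case
  proof (rule Ck_on_SucI[OF open_UNIV])
    show "(flat_exp n has_derivative
        (\<lambda>v. (flat_exp (n + 2) t + (- real n) * flat_exp (n + 1) t) * v)) (at t)" for t
      using flat_exp_deriv[of n t] by (simp add: has_field_derivative_def)
    show "Ck_on k UNIV (\<lambda>t. (flat_exp (n + 2) t + (- real n) * flat_exp (n + 1) t) * v)" for v
      by (intro Ck_on_mult Ck_on_add Ck_on_const Suc open_UNIV)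
  qed
qed

lemma Ck_on_compose_real:
  fixes g :: "real \<Rightarrow> real" and T :: "'a::real_normed_vector \<Rightarrow> real"
  assumes "open S" "Ck_on k S T" "Ck_on k UNIV g"
  shows "Ck_on k S (\<lambda>x. g (T x))"
proof (rule Ck_on_compose[where B = "{1}" and S' = UNIV and g = g and T = T])
  have "x \<in> span {1::real}" for x
    using span_scale[OF span_base[of 1 "{1::real}"], of x] by simp
  then show "span {1::real} = UNIV" by blast
qed (use assms in auto)

text \<open>The usual quotient of flat functions. The first summand of the denominator is positive
  for \<open>t < 1\<close> and the second for \<open>t > 1/2\<close>, so the denominator vanishes
  nowhere.\<close>

definition smooth_step :: "real \<Rightarrow> real" where
  "smooth_step t = flat_exp 0 (1 - t) * inverse (flat_exp 0 (1 - t) + flat_exp 0 (t - 1/2))"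

lemma smooth_step_simps:
  "t \<le> 1/2 \<Longrightarrow> smooth_step t = 1" "t \<ge> 1 \<Longrightarrow> smooth_step t = 0"
  by (auto simp: smooth_step_def flat_exp_def)

lemma Ck_on_smooth_step: "Ck_on k UNIV smooth_step"
proof -
  have "Ck_on k UNIV (\<lambda>t::real. 1 + (- 1) * t)"
    by (rule Ck_on_add[OF open_UNIV Ck_on_const Ck_on_bounded_linear[OF bounded_linear_mult_right open_UNIV]])
  moreover have "Ck_on k UNIV (\<lambda>t::real. t + (- 1/2))"
    by (rule Ck_on_add[OF open_UNIV Ck_on_bounded_linear[OF bounded_linear_ident open_UNIV] Ck_on_const])
  ultimately have 1: "Ck_on k UNIV (\<lambda>t. flat_exp 0 (1 + (- 1) * t))" "Ck_on k UNIV (\<lambda>t. flat_exp 0 (t + (- 1/2)))"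
    using Ck_on_compose_real[OF open_UNIV _ Ck_on_flat_exp] by blast+
  have nz: "flat_exp 0 (1 + (- 1) * t) + flat_exp 0 (t + (- 1/2)) \<noteq> 0" for t
    by (simp add: flat_exp_def) (smt (verit, best) exp_gt_zero)
  show ?thesis
    using Ck_on_mult[OF open_UNIV 1(1) Ck_on_inverse[OF open_UNIV Ck_on_add[OF open_UNIV 1] nz]]
    by (rule Ck_on_cong[OF open_UNIV, rotated]) (simp add: smooth_step_def)
qed

text \<open>Each new vector adds a compact segment, and a Minkowski sum of two compact sets is
  compact.\<close>

lemma compact_combinations:
  fixes C :: "'b::real_normed_vector set"
  assumes "finite C"
  shows "compact {\<Sum>b\<in>C. t b *\<^sub>R b |t. \<forall>b\<in>C. \<bar>t b\<bar> \<le> R b}" (is "compact (?K C)")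
  using assms
proof (induction C)
  case empty
  then show ?case by simp
next
  case (insert b C)
  have "?K (insert b C) = {x + y | x y. x \<in> (\<lambda>s. s *\<^sub>R b) ` {- R b..R b} \<and> y \<in> ?K C}"
  proof (intro equalityI subsetI)
    fix v assume "v \<in> ?K (insert b C)"
    then obtain t where t: "v = (\<Sum>c\<in>insert b C. t c *\<^sub>R c)" "\<forall>c\<in>insert b C. \<bar>t c\<bar> \<le> R c"
      by blast
    then have "v = t b *\<^sub>R b + (\<Sum>c\<in>C. t c *\<^sub>R c)" "t b \<in> {- R b..R b}"
      using insert.hyps by auto
    then show "v \<in> {x + y | x y. x \<in> (\<lambda>s. s *\<^sub>R b) ` {- R b..R b} \<and> y \<in> ?K C}"
      using t(2) by blast
  next
    fix v assume "v \<in> {x + y | x y. x \<in> (\<lambda>s. s *\<^sub>R b) ` {- R b..R b} \<and> y \<in> ?K C}"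
    then obtain s t where st: "v = s *\<^sub>R b + (\<Sum>c\<in>C. t c *\<^sub>R c)" "s \<in> {- R b..R b}"
      "\<forall>c\<in>C. \<bar>t c\<bar> \<le> R c" by blast
    have "(\<Sum>c\<in>C. (t(b := s)) c *\<^sub>R c) = (\<Sum>c\<in>C. t c *\<^sub>R c)"
      by (rule sum.cong) (use insert.hyps in auto)
    then have "v = (\<Sum>c\<in>insert b C. (t(b := s)) c *\<^sub>R c)" using insert.hyps st by simp
    moreover have "\<forall>c\<in>insert b C. \<bar>(t(b := s)) c\<bar> \<le> R c" using st by auto
    ultimately show "v \<in> ?K (insert b C)" by blast
  qed
  moreover have "compact ((\<lambda>s. s *\<^sub>R b) ` {- R b..R b})"
    by (intro compact_continuous_image continuous_intros) auto
  ultimately show ?case using compact_sums[OF _ insert.IH] by (simp only:)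
qed

text \<open>Cauchy-Schwarz bounds the coordinates of the points of the ball, so the ball is a closed
  subset of a compact set of combinations. This will make supports of bump functions closed in the
  manifold.\<close>

lemma compact_cball_finite_span:
  assumes "finite B" "span B = (UNIV :: 'b::real_inner set)"
  shows "compact (cball (z::'b) r)"
proof -
  obtain C c where C: "finite C" "\<And>v::'b. v = (\<Sum>b\<in>C. inner v (c b) *\<^sub>R b)"
    using finite_coordinates[OF assms] by blast
  let ?K = "{\<Sum>b\<in>C. t b *\<^sub>R b |t. \<forall>b\<in>C. \<bar>t b\<bar> \<le> (norm z + r) * norm (c b)}"
  have "v \<in> ?K" if "v \<in> cball z r" for v
  proof -
    have "norm v \<le> norm z + r"
      using that norm_triangle_ineq3[of v z] by (simp add: dist_norm norm_minus_commute)
    then have "\<bar>inner v (c b)\<bar> \<le> (norm z + r) * norm (c b)" for b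
      by (meson Cauchy_Schwarz_ineq2 mult_right_mono norm_ge_zero order_trans)
    then have "\<exists>t. (\<Sum>b\<in>C. inner v (c b) *\<^sub>R b) = (\<Sum>b\<in>C. t b *\<^sub>R b) \<and>
        (\<forall>b\<in>C. \<bar>t b\<bar> \<le> (norm z + r) * norm (c b))"
      by (intro exI[of _ "\<lambda>b. inner v (c b)"]) simp
    then show ?thesis by (subst C(2)[of v]) (rule CollectI)
  qed
  then have eq: "?K \<inter> cball z r = cball z r" by blast
  have "compact (?K \<inter> cball z r)"
    by (rule compact_Int_closed[OF compact_combinations[OF C(1)] closed_cball])
  then show ?thesis unfolding eq .
qed

section \<open>Smooth functions on the manifold\<close>

locale smooth_manifold =
  fixes C :: "('m::{t2_space,second_countable_topology}, 'b::real_inner) chart set"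
  assumes atlas: "smooth_atlas C"
begin

abbreviation smooth :: "'m set \<Rightarrow> ('m \<Rightarrow> real) \<Rightarrow> bool" where
  "smooth \<equiv> smooth_fun_on C"

lemma smooth_iff:
  "smooth W f \<longleftrightarrow> (\<forall>(U, \<phi>)\<in>C. \<forall>k. Ck_on k (\<phi> ` (U \<inter> W)) (\<lambda>z. f (inv_into U \<phi> z)))"
  by (simp add: smooth_fun_on_def Cinf_on_def comp_def)

lemma chart:
  assumes "(U, \<phi>) \<in> C"
  shows "open U" "homeomorphism U (\<phi> ` U) \<phi> (inv_into U \<phi>)" "inj_on \<phi> U" "open (\<phi> ` U)"
proof -
  have *: "open U \<and> open (\<phi> ` U) \<and> homeomorphism U (\<phi> ` U) \<phi> (inv_into U \<phi>)"
    using atlas assms unfolding smooth_atlas_def by blast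
  then show "open U" "homeomorphism U (\<phi> ` U) \<phi> (inv_into U \<phi>)" "open (\<phi> ` U)" by auto
  from * show "inj_on \<phi> U" by (metis homeomorphism_apply1 inj_on_inverseI)
qed

lemma inv_chart:
  assumes "(U, \<phi>) \<in> C" "y \<in> U"
  shows "inv_into U \<phi> (\<phi> y) = y"
  using chart(3)[OF assms(1)] assms(2) by simp

lemma open_chart_image:
  assumes "(U, \<phi>) \<in> C" "open W"
  shows "open (\<phi> ` (U \<inter> W))"
proof -
  have "openin (top_of_set U) (U \<inter> W)" using assms(2) by (simp add: openin_open_Int)
  then have "openin (top_of_set (\<phi> ` U)) (\<phi> ` (U \<inter> W))"
    using homeomorphism_imp_open_map[OF chart(2)[OF assms(1)]] by blast
  then show ?thesis using chart(4)[OF assms(1)] openin_open_trans by blast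
qed

lemma smooth_cong:
  assumes "open W" "\<And>x. x \<in> W \<Longrightarrow> f x = g x" "smooth W f"
  shows "smooth W g"
  unfolding smooth_iff
proof clarify
  fix U \<phi> k assume U: "(U, \<phi>) \<in> C"
  show "Ck_on k (\<phi> ` (U \<inter> W)) (\<lambda>z. g (inv_into U \<phi> z))"
    by (rule Ck_on_cong[OF open_chart_image[OF U \<open>open W\<close>], where f = "\<lambda>z. f (inv_into U \<phi> z)"])
      (use assms U in \<open>auto simp: smooth_iff inv_chart\<close>)
qed

lemma smooth_mono:
  assumes "smooth W f" "V \<subseteq> W"
  shows "smooth V f"
  unfolding smooth_iff
proof clarify
  fix U \<phi> k assume U: "(U, \<phi>) \<in> C"
  show "Ck_on k (\<phi> ` (U \<inter> V)) (\<lambda>z. f (inv_into U \<phi> z))"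
    by (rule Ck_on_subset[where S = "\<phi> ` (U \<inter> W)"]) (use assms U in \<open>auto simp: smooth_iff\<close>)
qed

lemma smooth_local:
  assumes "\<And>x. x \<in> W \<Longrightarrow> \<exists>V. open V \<and> x \<in> V \<and> smooth V f"
  shows "smooth W f"
  unfolding smooth_iff
proof (clarify, rule Ck_on_local)
  fix U \<phi> k z assume U: "(U, \<phi>) \<in> C" and "z \<in> \<phi> ` (U \<inter> W)"
  then obtain x where x: "z = \<phi> x" "x \<in> U" "x \<in> W" by blast
  obtain V where V: "open V" "x \<in> V" "smooth V f" using assms[OF x(3)] by blast
  then show "\<exists>T. open T \<and> z \<in> T \<and> Ck_on k T (\<lambda>z. f (inv_into U \<phi> z))"
    using U x open_chart_image[OF U V(1)] by (intro exI[of _ "\<phi> ` (U \<inter> V)"]) (auto simp: smooth_iff)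
qed

lemma smooth_const: "smooth W (\<lambda>x. c)"
  by (auto simp: smooth_iff Ck_on_const)

lemma smooth_add:
  "open W \<Longrightarrow> smooth W f \<Longrightarrow> smooth W g \<Longrightarrow> smooth W (\<lambda>x. f x + g x)"
  unfolding smooth_iff by (fast intro: Ck_on_add open_chart_image)

lemma smooth_mult:
  "open W \<Longrightarrow> smooth W f \<Longrightarrow> smooth W g \<Longrightarrow> smooth W (\<lambda>x. f x * g x)"
  unfolding smooth_iff by (fast intro: Ck_on_mult open_chart_image)

lemma smooth_minus:
  assumes "open W" "smooth W f"
  shows "smooth W (\<lambda>x. - f x)"
  using smooth_mult[OF assms(1) smooth_const[of _ "-1"] assms(2)] by simp

lemma smooth_diff:
  assumes "open W" "smooth W f" "smooth W g"
  shows "smooth W (\<lambda>x. f x - g x)"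
  using smooth_add[OF assms(1,2) smooth_minus[OF assms(1,3)]] by simp

lemma smooth_sum:
  assumes "open W" "\<And>i. i \<in> I \<Longrightarrow> smooth W (f i)"
  shows "smooth W (\<lambda>x. \<Sum>i\<in>I. f i x)"
  using assms(2) by (induction I rule: infinite_finite_induct) (auto intro: smooth_const smooth_add[OF assms(1)])

lemma smooth_prod:
  assumes "open W" "\<And>i. i \<in> I \<Longrightarrow> smooth W (f i)"
  shows "smooth W (\<lambda>x. \<Prod>i\<in>I. f i x)"
  using assms(2) by (induction I rule: infinite_finite_induct) (auto intro: smooth_const smooth_mult[OF assms(1)])

text \<open>Extension by zero: around a point of \<open>K\<close> both factors are smooth on
  \<open>V \<inter> U\<close>, and the open complement of \<open>K\<close> sees the constant 0,
  whatever \<open>f\<close> does outside \<open>U\<close>.\<close>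

lemma smooth_cut_off:
  assumes "smooth UNIV \<theta>" "open V" "smooth (V \<inter> U) f"
    and "open U" "closed K" "K \<subseteq> U" "\<And>y. y \<notin> K \<Longrightarrow> \<theta> y = 0"
  shows "smooth V (\<lambda>y. \<theta> y * f y)"
proof (rule smooth_local)
  fix x assume "x \<in> V"
  show "\<exists>V. open V \<and> x \<in> V \<and> smooth V (\<lambda>y. \<theta> y * f y)"
  proof (cases "x \<in> K")
    case True
    then have "open (V \<inter> U)" "x \<in> V \<inter> U" "smooth (V \<inter> U) (\<lambda>y. \<theta> y * f y)"
      using \<open>x \<in> V\<close> assms by (auto intro!: smooth_mult smooth_mono[OF assms(1)])
    then show ?thesis by blast
  next
    case False
    have "smooth (V - K) (\<lambda>y. \<theta> y * f y)"
      by (rule smooth_cong[OF _ _ smooth_const[of _ 0]]) (use assms in auto)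
    then show ?thesis using False \<open>x \<in> V\<close> assms by (metis Diff_iff open_Diff)
  qed
qed

lemma bump_function:
  assumes "open W" "x \<in> W"
  obtains \<theta> V K where "smooth UNIV \<theta>" "open V" "x \<in> V" "\<And>y. y \<in> V \<Longrightarrow> \<theta> y = 1"
    "closed K" "K \<subseteq> W" "\<And>y. y \<notin> K \<Longrightarrow> \<theta> y = 0"
proof -
  obtain B :: "'b set" where B: "finite B" "span B = UNIV"
    using atlas unfolding smooth_atlas_def by blast
  have "\<exists>(U, \<phi>)\<in>C. x \<in> U" using atlas unfolding smooth_atlas_def by blast
  then obtain U \<phi> where U: "(U, \<phi>) \<in> C" "x \<in> U" by blast
  let ?I = "inv_into U \<phi>"
  have hom: "continuous_on U \<phi>" "continuous_on (\<phi> ` U) ?I"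
    using chart(2)[OF U(1)] by (auto simp: homeomorphism_def)
  have "open (\<phi> ` (U \<inter> W))" "\<phi> x \<in> \<phi> ` (U \<inter> W)"
    using U assms open_chart_image by auto
  then obtain r where r: "r > 0" "cball (\<phi> x) r \<subseteq> \<phi> ` (U \<inter> W)"
    by (meson open_contains_cball)
  define K where "K = ?I ` cball (\<phi> x) r"
  \<comment> \<open>The square of the distance in units of \<open>r\<close>, since the norm itself
    is not smooth at the centre.\<close>
  define q where "q z = inner (z - \<phi> x) (z - \<phi> x) * inverse (r\<^sup>2)" for z
  define \<theta> where "\<theta> y = (if y \<in> U then smooth_step (q (\<phi> y)) else 0)" for y
  define V where "V = U \<inter> \<phi> -` ball (\<phi> x) (r / 2)"
  have q: "q z = (norm (z - \<phi> x) / r)\<^sup>2" for z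
    by (simp add: q_def dot_square_norm field_simps)
  have "K \<subseteq> U \<inter> W" using r(2) inv_chart[OF U(1)] by (auto simp: K_def)
  \<comment> \<open>Compactness passes through the inverse chart and gives closedness in the whole
    Hausdorff manifold. Closedness relative to \<open>U\<close> alone would not justify extending by
    zero.\<close>
  have "compact K" unfolding K_def
    by (rule compact_continuous_image[OF continuous_on_subset[OF hom(2)] compact_cball_finite_span[OF B]])
      (use r(2) in auto)
  then have "closed K" by (rule compact_imp_closed)
  have supp: "\<theta> y = 0" if "y \<notin> K" for y
  proof (cases "y \<in> U")
    case True
    then have "\<phi> y \<notin> cball (\<phi> x) r" using that inv_chart[OF U(1) True] by (force simp: K_def)
    then have "1 \<le> norm (\<phi> y - \<phi> x) / r" using r(1) by (simp add: dist_norm norm_minus_commute)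
    then have "q (\<phi> y) \<ge> 1" unfolding q by (rule one_le_power)
    then show ?thesis by (simp add: \<theta>_def smooth_step_simps)
  qed (simp add: \<theta>_def)
  have "open V" unfolding V_def
    using continuous_open_preimage[OF hom(1) chart(1)[OF U(1)] open_ball] .
  have one: "\<theta> y = 1" if "y \<in> V" for y
  proof -
    have "norm (\<phi> y - \<phi> x) / r \<le> 1/2"
      using that r(1) by (simp add: V_def dist_norm norm_minus_commute)
    then have "q (\<phi> y) \<le> (1/2)\<^sup>2" unfolding q using r(1) by (intro power_mono) auto
    also have "\<dots> \<le> (1/2 :: real)" by (simp add: power2_eq_square)
    finally show ?thesis using that by (simp add: \<theta>_def V_def smooth_step_simps)
  qed
  have smooth_U: "smooth U \<theta>"
    unfolding smooth_iff
  proof clarify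
    fix V \<psi> k assume V: "(V, \<psi>) \<in> C"
    \<comment> \<open>In any chart \<open>\<psi>\<close> the bump is one fixed function of the model
      space composed with this transition map, which the atlas makes smooth.\<close>
    let ?T = "\<phi> \<circ> inv_into V \<psi>"
    have op: "open (\<psi> ` (V \<inter> U))" using open_chart_image[OF V chart(1)[OF U(1)]] .
    have T: "Ck_on k (\<psi> ` (V \<inter> U)) ?T"
      using atlas U(1) V unfolding smooth_atlas_def Cinf_on_def by fast
    have "Ck_on k UNIV (\<lambda>z. smooth_step (q z))"
      unfolding q_def
      by (rule Ck_on_compose_real[OF open_UNIV
            Ck_on_mult[OF open_UNIV Ck_on_norm_square Ck_on_const] Ck_on_smooth_step])
    then have "Ck_on k (\<psi> ` (V \<inter> U)) (\<lambda>z. smooth_step (q (?T z)))"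
      by (rule Ck_on_compose[OF B op subset_UNIV T])
    then show "Ck_on k (\<psi> ` (V \<inter> U)) (\<lambda>z. \<theta> (inv_into V \<psi> z))"
      by (rule Ck_on_cong[OF op, rotated]) (use inv_chart[OF V] in \<open>auto simp: \<theta>_def\<close>)
  qed
  have "smooth UNIV \<theta>"
  proof (rule smooth_local)
    fix y
    have "smooth (- K) \<theta>"
      by (rule smooth_cong[OF _ _ smooth_const[of _ 0]]) (use supp \<open>closed K\<close> in auto)
    then show "\<exists>V. open V \<and> y \<in> V \<and> smooth V \<theta>"
      using smooth_U chart(1)[OF U(1)] \<open>closed K\<close> \<open>K \<subseteq> U \<inter> W\<close>
      by (cases "y \<in> K") (blast, meson ComplI open_Compl)
  qed
  then show thesis
    using that[of \<theta> V K] \<open>open V\<close> one \<open>closed K\<close> \<open>K \<subseteq> U \<inter> W\<close> supp r(1) U(2) by (auto simp: V_def)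
qed

end

section \<open>Sections and bivectors\<close>

locale smooth_bundle =
  fixes A :: "('m::{t2_space,second_countable_topology}, 'b::real_inner, 'e::real_vector, 'z)
    vec_bundle_scheme"
  assumes vector_bundle: "vector_bundle A"
begin

sublocale smooth_manifold "atlas A"
  using vector_bundle unfolding vector_bundle_def by unfold_locales blast

lemma frame:
  assumes "(U, e) \<in> frames A"
  shows open_frame: "open U"
    and frame_inj: "y \<in> U \<Longrightarrow> inj_on (\<lambda>i. e i y) {..<bundle_rank A}"
    and frame_independent: "y \<in> U \<Longrightarrow> independent ((\<lambda>i. e i y) ` {..<bundle_rank A})"
    and frame_span: "y \<in> U \<Longrightarrow> span ((\<lambda>i. e i y) ` {..<bundle_rank A}) = fibre A y"
proof -
  have "\<forall>(U, e)\<in>frames A. open U \<and>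
        (\<forall>x\<in>U. inj_on (\<lambda>i. e i x) {..<bundle_rank A} \<and>
                independent ((\<lambda>i. e i x) ` {..<bundle_rank A}) \<and>
                span ((\<lambda>i. e i x) ` {..<bundle_rank A}) = fibre A x)"
    using vector_bundle unfolding vector_bundle_def by (elim conjE)
  from bspec[OF this assms] show "open U"
    "y \<in> U \<Longrightarrow> inj_on (\<lambda>i. e i y) {..<bundle_rank A}"
    "y \<in> U \<Longrightarrow> independent ((\<lambda>i. e i y) ` {..<bundle_rank A})"
    "y \<in> U \<Longrightarrow> span ((\<lambda>i. e i y) ` {..<bundle_rank A}) = fibre A y"
    by auto
qed

lemma frame_exists: obtains U e where "(U, e) \<in> frames A" "x \<in> U"
proof -
  have "\<forall>x. \<exists>(U, e)\<in>frames A. x \<in> U"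
    using vector_bundle unfolding vector_bundle_def by (elim conjE)
  then show thesis using that by fast
qed

lemma smooth_transition:
  assumes "(U, e) \<in> frames A" "(V, e') \<in> frames A" "i < bundle_rank A" "j < bundle_rank A"
  shows "smooth (U \<inter> V) (\<lambda>x. coframe A e i x (e' j x))"
proof -
  have "\<forall>(U, e)\<in>frames A. \<forall>(V, e')\<in>frames A. \<forall>i<bundle_rank A. \<forall>j<bundle_rank A.
        smooth (U \<inter> V) (\<lambda>x. coframe A e i x (e' j x))"
    using vector_bundle unfolding vector_bundle_def by (elim conjE)
  then show ?thesis using assms by fast
qed

section \<open>Linear algebra of fibres and dual fibres\<close>

lemma subspace_fibre: "subspace (fibre A x)"
proof -
  obtain U e where "(U, e) \<in> frames A" "x \<in> U" by (rule frame_exists)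
  then show ?thesis using frame_span subspace_span by metis
qed

lemma frame_mem:
  assumes "(U, e) \<in> frames A" "y \<in> U" "i < bundle_rank A"
  shows "e i y \<in> fibre A y"
  unfolding frame_span[OF assms(1,2), symmetric] using assms(3) by (intro span_base) auto

lemma dual_fibre_add: "\<xi> \<in> dual_fibre A x \<Longrightarrow> u \<in> fibre A x \<Longrightarrow> v \<in> fibre A x \<Longrightarrow> \<xi> (u + v) = \<xi> u + \<xi> v"
  and dual_fibre_scale: "\<xi> \<in> dual_fibre A x \<Longrightarrow> u \<in> fibre A x \<Longrightarrow> \<xi> (c *\<^sub>R u) = c * \<xi> u"
  and dual_fibre_outside: "\<xi> \<in> dual_fibre A x \<Longrightarrow> u \<notin> fibre A x \<Longrightarrow> \<xi> u = 0"
  by (simp_all add: dual_fibre_def)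

lemma dual_fibre_zero: "\<xi> \<in> dual_fibre A x \<Longrightarrow> \<xi> 0 = 0"
  using dual_fibre_scale[of \<xi> x 0 0] subspace_0[OF subspace_fibre] by simp

lemma dual_fibre_sum:
  assumes "\<xi> \<in> dual_fibre A x" "\<And>i. i \<in> I \<Longrightarrow> u i \<in> fibre A x"
  shows "\<xi> (\<Sum>i\<in>I. u i) = (\<Sum>i\<in>I. \<xi> (u i))"
  using assms(2)
  by (induction I rule: infinite_finite_induct)
    (simp_all add: dual_fibre_zero[OF assms(1)] dual_fibre_add[OF assms(1)] subspace_sum[OF subspace_fibre])

lemma zero_mem_dual_fibre: "(\<lambda>u. 0) \<in> dual_fibre A x"
  and add_mem_dual_fibre: "\<xi> \<in> dual_fibre A x \<Longrightarrow> \<eta> \<in> dual_fibre A x \<Longrightarrow> (\<lambda>u. \<xi> u + \<eta> u) \<in> dual_fibre A x"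
  and scale_mem_dual_fibre: "\<xi> \<in> dual_fibre A x \<Longrightarrow> (\<lambda>u. c * \<xi> u) \<in> dual_fibre A x"
  by (simp_all add: dual_fibre_def algebra_simps)

lemma sum_mem_dual_fibre:
  assumes "\<And>i. i \<in> I \<Longrightarrow> \<xi> i \<in> dual_fibre A x"
  shows "(\<lambda>u. \<Sum>i\<in>I. a i * \<xi> i u) \<in> dual_fibre A x"
  using assms
  by (induction I rule: infinite_finite_induct)
    (simp_all add: zero_mem_dual_fibre add_mem_dual_fibre scale_mem_dual_fibre)

lemma coframe_mem:
  assumes "(U, e) \<in> frames A" "y \<in> U"
  shows "coframe A e i y \<in> dual_fibre A y"
  using frame_independent[OF assms] frame_span[OF assms]
  by (auto simp: dual_fibre_def coframe_def representation_add representation_scale)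
    (simp add: representation_def)

lemma coframe_frame:
  assumes "(U, e) \<in> frames A" "y \<in> U" "i < bundle_rank A" "j < bundle_rank A"
  shows "coframe A e i y (e j y) = (if i = j then 1 else 0)"
proof -
  have "(e i y = e j y) = (i = j)"
    using inj_on_eq_iff[OF frame_inj[OF assms(1,2)], of i j] assms(3,4) by simp
  then show ?thesis
    using representation_basis[OF frame_independent[OF assms(1,2)], of "e j y"] assms(3,4)
    by (simp add: coframe_def)
qed

lemma frame_expansion:
  assumes "(U, e) \<in> frames A" "y \<in> U" "v \<in> fibre A y"
  shows "v = (\<Sum>i<bundle_rank A. coframe A e i y v *\<^sub>R e i y)"
proof -
  let ?E = "(\<lambda>i. e i y) ` {..<bundle_rank A}"
  have "(\<Sum>b\<in>?E. representation ?E v b *\<^sub>R b) = v"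
    by (rule sum_representation_eq) (use frame_independent[OF assms(1,2)] frame_span[OF assms(1,2)] assms(3) in auto)
  then show ?thesis
    by (simp add: coframe_def sum.reindex[OF frame_inj[OF assms(1,2)]])
qed

text \<open>An equality of functions on all of \<open>'e\<close>: outside the fibre both sides are 0
  by the convention for functionals.\<close>

lemma dual_expansion:
  assumes "(U, e) \<in> frames A" "y \<in> U" "\<xi> \<in> dual_fibre A y"
  shows "\<xi> = (\<lambda>u. \<Sum>i<bundle_rank A. \<xi> (e i y) * coframe A e i y u)"
proof
  fix u
  show "\<xi> u = (\<Sum>i<bundle_rank A. \<xi> (e i y) * coframe A e i y u)"
  proof (cases "u \<in> fibre A y")
    case True
    have "\<xi> u = \<xi> (\<Sum>i<bundle_rank A. coframe A e i y u *\<^sub>R e i y)"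
      using frame_expansion[OF assms(1,2) True] by simp
    also have "\<dots> = (\<Sum>i<bundle_rank A. \<xi> (coframe A e i y u *\<^sub>R e i y))"
      by (intro dual_fibre_sum[OF assms(3)] subspace_scale[OF subspace_fibre] frame_mem[OF assms(1,2)]) auto
    also have "\<dots> = (\<Sum>i<bundle_rank A. \<xi> (e i y) * coframe A e i y u)"
      by (intro sum.cong refl) (simp add: dual_fibre_scale[OF assms(3) frame_mem[OF assms(1,2)]])
    finally show ?thesis .
  next
    case False
    then show ?thesis
      using dual_fibre_outside[OF coframe_mem[OF assms(1,2)]] dual_fibre_outside[OF assms(3)] by simp
  qed
qed

text \<open>The coframe lies in the dual fibre and already determines a vector through its
  coefficients.\<close>

lemma fibre_eqI:
  assumes "u \<in> fibre A x" "v \<in> fibre A x" "\<And>\<eta>. \<eta> \<in> dual_fibre A x \<Longrightarrow> \<eta> u = \<eta> v"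
  shows "u = v"
proof -
  obtain U e where e: "(U, e) \<in> frames A" "x \<in> U" by (rule frame_exists)
  have "coframe A e i x u = coframe A e i x v" for i
    by (rule assms(3)[OF coframe_mem[OF e]])
  then show ?thesis using frame_expansion[OF e assms(1)] frame_expansion[OF e assms(2)] by simp
qed

section \<open>Global sections and their construction from local data\<close>

lemma sections_fibre: "s \<in> sections A \<Longrightarrow> s x \<in> fibre A x"
  by (simp add: sections_def)

lemma sections_smooth:
  assumes "s \<in> sections A" "(U, e) \<in> frames A" "i < bundle_rank A"
  shows "smooth U (\<lambda>x. coframe A e i x (s x))"
  using assms unfolding sections_def by fast

lemma sectionsI:
  assumes "\<And>x. s x \<in> fibre A x"
    and "\<And>U e i. (U, e) \<in> frames A \<Longrightarrow> i < bundle_rank A \<Longrightarrow> smooth U (\<lambda>x. coframe A e i x (s x))"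
  shows "s \<in> sections A"
  using assms unfolding sections_def by blast

lemma dual_sections_fibre: "\<xi> \<in> dual_sections A \<Longrightarrow> \<xi> x \<in> dual_fibre A x"
  by (simp add: dual_sections_def)

lemma dual_sections_smooth:
  assumes "\<xi> \<in> dual_sections A" "(U, e) \<in> frames A" "i < bundle_rank A"
  shows "smooth U (\<lambda>x. \<xi> x (e i x))"
  using assms unfolding dual_sections_def by fast

lemma dual_sectionsI:
  assumes "\<And>x. \<xi> x \<in> dual_fibre A x"
    and "\<And>U e i. (U, e) \<in> frames A \<Longrightarrow> i < bundle_rank A \<Longrightarrow> smooth U (\<lambda>x. \<xi> x (e i x))"
  shows "\<xi> \<in> dual_sections A"
  using assms unfolding dual_sections_def by blast

lemma sections_zero: "(\<lambda>x. 0) \<in> sections A"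
proof (rule sectionsI)
  fix U e i assume e: "(U, e) \<in> frames A"
  show "smooth U (\<lambda>x. coframe A e i x 0)"
    by (rule smooth_cong[OF open_frame[OF e] _ smooth_const[of _ 0]])
      (simp add: dual_fibre_zero[OF coframe_mem[OF e]])
qed (rule subspace_0[OF subspace_fibre])

lemma sections_add:
  assumes "s \<in> sections A" "t \<in> sections A"
  shows "(\<lambda>x. s x + t x) \<in> sections A"
proof (rule sectionsI)
  fix U e i assume e: "(U, e) \<in> frames A" "i < bundle_rank A"
  show "smooth U (\<lambda>x. coframe A e i x (s x + t x))"
    by (rule smooth_cong[OF open_frame[OF e(1)] _ smooth_add[OF open_frame[OF e(1)]
            sections_smooth[OF assms(1) e] sections_smooth[OF assms(2) e]]])
      (simp add: dual_fibre_add[OF coframe_mem[OF e(1)]] sections_fibre assms)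
qed (intro subspace_add[OF subspace_fibre] sections_fibre assms)

lemma sections_scale:
  assumes "smooth UNIV f" "s \<in> sections A"
  shows "(\<lambda>x. f x *\<^sub>R s x) \<in> sections A"
proof (rule sectionsI)
  fix U e i assume e: "(U, e) \<in> frames A" "i < bundle_rank A"
  show "smooth U (\<lambda>x. coframe A e i x (f x *\<^sub>R s x))"
    by (rule smooth_cong[OF open_frame[OF e(1)] _ smooth_mult[OF open_frame[OF e(1)]
            smooth_mono[OF assms(1) subset_UNIV] sections_smooth[OF assms(2) e]]])
      (simp add: dual_fibre_scale[OF coframe_mem[OF e(1)]] sections_fibre assms)
qed (intro subspace_scale[OF subspace_fibre] sections_fibre assms)

lemma sections_uminus:
  assumes "s \<in> sections A"
  shows "(\<lambda>x. - s x) \<in> sections A"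
  using sections_scale[OF smooth_const[of UNIV "-1"] assms] by simp

lemma sections_diff:
  assumes "s \<in> sections A" "t \<in> sections A"
  shows "(\<lambda>x. s x - t x) \<in> sections A"
  using sections_add[OF assms(1) sections_uminus[OF assms(2)]] by simp

lemma smooth_pairing:
  assumes "\<xi> \<in> dual_sections A" "s \<in> sections A"
  shows "smooth UNIV (\<lambda>x. \<xi> x (s x))"
proof (rule smooth_local)
  fix x
  obtain U e where e: "(U, e) \<in> frames A" "x \<in> U" by (rule frame_exists)
  have "smooth U (\<lambda>y. \<Sum>i<bundle_rank A. \<xi> y (e i y) * coframe A e i y (s y))"
    by (intro smooth_sum smooth_mult open_frame[OF e(1)] dual_sections_smooth[OF assms(1) e(1)]
        sections_smooth[OF assms(2) e(1)]) simp_all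
  then have "smooth U (\<lambda>x. \<xi> x (s x))"
    by (rule smooth_cong[OF open_frame[OF e(1)], rotated])
      (metis dual_expansion[OF e(1) _ dual_sections_fibre[OF assms(1)]])
  then show "\<exists>V. open V \<and> x \<in> V \<and> smooth V (\<lambda>x. \<xi> x (s x))"
    using e open_frame by blast
qed

text \<open>In another frame the coefficients are \<open>f\<close> times transition functions,
  smooth only on the overlap; \<open>smooth_cut_off\<close> extends their products with
  \<open>\<theta>\<close> by zero.\<close>

lemma local_section:
  assumes e: "(U, e) \<in> frames A" "i < bundle_rank A" and f: "smooth U f"
    and \<theta>: "smooth UNIV \<theta>" "closed K" "K \<subseteq> U" "\<And>y. y \<notin> K \<Longrightarrow> \<theta> y = 0"
  shows "(\<lambda>y. (\<theta> y * f y) *\<^sub>R e i y) \<in> sections A"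
proof (rule sectionsI)
  show mem: "(\<theta> y * f y) *\<^sub>R e i y \<in> fibre A y" for y
  proof (cases "y \<in> K")
    case True
    then show ?thesis using \<theta> e by (intro subspace_scale[OF subspace_fibre] frame_mem[OF e(1)]) auto
  qed (simp add: \<theta>(4) subspace_0[OF subspace_fibre])
  fix V e' j assume e': "(V, e') \<in> frames A" "j < bundle_rank A"
  note op = open_frame[OF e(1)] open_frame[OF e'(1)]
  have "smooth (V \<inter> U) (\<lambda>y. f y * coframe A e' j y (e i y))"
    by (intro smooth_mult smooth_mono[OF f] smooth_transition e e' open_Int op) simp
  from smooth_cut_off[OF \<theta>(1) op(2) this op(1) \<theta>(2,3,4)]
  show "smooth V (\<lambda>y. coframe A e' j y ((\<theta> y * f y) *\<^sub>R e i y))"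
  proof (rule smooth_cong[OF op(2), rotated])
    fix y assume y: "y \<in> V"
    show "\<theta> y * (f y * coframe A e' j y (e i y)) = coframe A e' j y ((\<theta> y * f y) *\<^sub>R e i y)"
    proof (cases "y \<in> K")
      case True
      then show ?thesis
        using dual_fibre_scale[OF coframe_mem[OF e'(1) y] frame_mem[OF e(1) _ e(2)]] \<theta>(3) by auto
    qed (simp add: \<theta>(4) dual_fibre_zero[OF coframe_mem[OF e'(1) y]])
  qed
qed

lemma local_dual_section:
  assumes e: "(U, e) \<in> frames A" and f: "\<And>i. i < bundle_rank A \<Longrightarrow> smooth U (f i)"
    and \<theta>: "smooth UNIV \<theta>" "closed K" "K \<subseteq> U" "\<And>y. y \<notin> K \<Longrightarrow> \<theta> y = 0"
  shows "(\<lambda>y u. \<Sum>i<bundle_rank A. (\<theta> y * f i y) * coframe A e i y u) \<in> dual_sections A"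
proof (rule dual_sectionsI)
  show "(\<lambda>u. \<Sum>i<bundle_rank A. (\<theta> y * f i y) * coframe A e i y u) \<in> dual_fibre A y" for y
  proof (cases "y \<in> K")
    case True
    then show ?thesis using \<theta>(3) by (intro sum_mem_dual_fibre coframe_mem[OF e]) auto
  qed (simp add: \<theta>(4) zero_mem_dual_fibre)
  fix V e' j assume e': "(V, e') \<in> frames A" "j < bundle_rank A"
  note op = open_frame[OF e(1)] open_frame[OF e'(1)]
  have "smooth (V \<inter> U) (\<lambda>y. \<Sum>i<bundle_rank A. f i y * coframe A e i y (e' j y))"
  proof (rule smooth_sum)
    fix i assume "i \<in> {..<bundle_rank A}"
    then have "smooth U (f i)" "smooth (V \<inter> U) (\<lambda>y. coframe A e i y (e' j y))"
      using f smooth_transition[OF e e'(1) _ e'(2)] by (auto simp: Int_commute)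
    then show "smooth (V \<inter> U) (\<lambda>y. f i y * coframe A e i y (e' j y))"
      by (intro smooth_mult open_Int op) (rule smooth_mono, auto)
  qed (use op in auto)
  from smooth_cut_off[OF \<theta>(1) op(2) this op(1) \<theta>(2,3,4)]
  show "smooth V (\<lambda>y. \<Sum>i<bundle_rank A. (\<theta> y * f i y) * coframe A e i y (e' j y))"
    by (simp add: sum_distrib_left mult.assoc)
qed

text \<open>Constant coefficients in a frame near \<open>x\<close>, cut off by a bump function. This
  replaces covectors at a point by sections, to which brackets and relations apply.\<close>

lemma dual_section_through:
  assumes "c \<in> dual_fibre A x"
  obtains \<xi> where "\<xi> \<in> dual_sections A" "\<xi> x = c"
proof -
  obtain U e where e: "(U, e) \<in> frames A" "x \<in> U" by (rule frame_exists)
  obtain \<theta> V K where \<theta>: "smooth UNIV \<theta>" "open V" "x \<in> V" "\<And>y. y \<in> V \<Longrightarrow> \<theta> y = 1"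
    "closed K" "K \<subseteq> U" "\<And>y. y \<notin> K \<Longrightarrow> \<theta> y = 0"
    by (rule bump_function[OF open_frame[OF e(1)] e(2)]) blast
  show thesis
  proof (rule that)
    show "(\<lambda>y u. \<Sum>i<bundle_rank A. (\<theta> y * c (e i x)) * coframe A e i y u) \<in> dual_sections A"
      by (rule local_dual_section[OF e(1) smooth_const \<theta>(1,5,6,7)])
    show "(\<lambda>u. \<Sum>i<bundle_rank A. (\<theta> x * c (e i x)) * coframe A e i x u) = c"
      using dual_expansion[OF e assms] \<theta>(3,4) by simp
  qed
qed

section \<open>Bivectors, their induced maps and their decompositions\<close>

lemma bivector_alternating: "P \<in> bivectors A \<Longrightarrow> \<xi> \<in> dual_fibre A x \<Longrightarrow> P x \<xi> \<xi> = 0"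
  by (simp add: bivectors_def)

lemma bivector_add:
  assumes "P \<in> bivectors A" "\<xi> \<in> dual_fibre A x" "\<eta> \<in> dual_fibre A x" "\<zeta> \<in> dual_fibre A x"
  shows "P x (\<lambda>u. \<xi> u + \<eta> u) \<zeta> = P x \<xi> \<zeta> + P x \<eta> \<zeta>"
    and "P x \<zeta> (\<lambda>u. \<xi> u + \<eta> u) = P x \<zeta> \<xi> + P x \<zeta> \<eta>"
  using assms by (simp_all add: bivectors_def)

lemma bivector_scale:
  assumes "P \<in> bivectors A" "\<xi> \<in> dual_fibre A x" "\<eta> \<in> dual_fibre A x"
  shows "P x (\<lambda>u. c * \<xi> u) \<eta> = c * P x \<xi> \<eta>" and "P x \<eta> (\<lambda>u. c * \<xi> u) = c * P x \<eta> \<xi>"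
  using assms by (simp_all add: bivectors_def)

lemma bivector_smooth:
  assumes "P \<in> bivectors A" "(U, e) \<in> frames A" "i < bundle_rank A" "j < bundle_rank A"
  shows "smooth U (\<lambda>x. P x (coframe A e i x) (coframe A e j x))"
  using assms unfolding bivectors_def by fast

lemma bivector_skew:
  assumes "P \<in> bivectors A" "\<xi> \<in> dual_fibre A x" "\<eta> \<in> dual_fibre A x"
  shows "P x \<xi> \<eta> = - P x \<eta> \<xi>"
proof -
  have "0 = P x (\<lambda>u. \<xi> u + \<eta> u) (\<lambda>u. \<xi> u + \<eta> u)"
    using bivector_alternating[OF assms(1) add_mem_dual_fibre[OF assms(2,3)]] by simp
  also have "\<dots> = P x \<xi> (\<lambda>u. \<xi> u + \<eta> u) + P x \<eta> (\<lambda>u. \<xi> u + \<eta> u)"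
    by (rule bivector_add(1)[OF assms add_mem_dual_fibre[OF assms(2,3)]])
  also have "\<dots> = P x \<xi> \<eta> + P x \<eta> \<xi>"
    unfolding bivector_add(2)[OF assms assms(2)] bivector_add(2)[OF assms assms(3)]
    using bivector_alternating[OF assms(1)] assms(2,3) by simp
  finally show ?thesis by simp
qed

lemma bivector_zero:
  assumes "P \<in> bivectors A" "\<eta> \<in> dual_fibre A x"
  shows "P x \<eta> (\<lambda>u. 0) = 0"
  using bivector_scale(2)[OF assms(1) zero_mem_dual_fibre assms(2), of 0] by simp

lemma bivector_sum:
  assumes "P \<in> bivectors A" "\<eta> \<in> dual_fibre A x" "\<And>i. i \<in> I \<Longrightarrow> \<xi> i \<in> dual_fibre A x"
  shows "P x \<eta> (\<lambda>u. \<Sum>i\<in>I. a i * \<xi> i u) = (\<Sum>i\<in>I. a i * P x \<eta> (\<xi> i))"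
  using assms(3)
proof (induction I rule: infinite_finite_induct)
  case (insert i I)
  have "P x \<eta> (\<lambda>u. a i * \<xi> i u + (\<Sum>i\<in>I. a i * \<xi> i u))
      = P x \<eta> (\<lambda>u. a i * \<xi> i u) + P x \<eta> (\<lambda>u. \<Sum>i\<in>I. a i * \<xi> i u)"
    by (rule bivector_add(2)[OF assms(1) scale_mem_dual_fibre sum_mem_dual_fibre assms(2)])
      (use insert.prems in auto)
  then show ?case using insert by (simp add: bivector_scale[OF assms(1) _ assms(2)])
qed (simp_all add: bivector_zero assms)

lemma bivector_expansion:
  assumes "P \<in> bivectors A" "(U, e) \<in> frames A" "y \<in> U" "\<xi> \<in> dual_fibre A y" "\<eta> \<in> dual_fibre A y"
  shows "P y \<xi> \<eta> = (\<Sum>i<bundle_rank A. \<eta> (e i y) * P y \<xi> (coframe A e i y))"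
  by (subst dual_expansion[OF assms(2,3,5)])
    (rule bivector_sum[OF assms(1,4) coframe_mem[OF assms(2,3)]])

lemma bivector_expansion2:
  assumes "P \<in> bivectors A" "(U, e) \<in> frames A" "y \<in> U" "\<xi> \<in> dual_fibre A y" "\<eta> \<in> dual_fibre A y"
  shows "P y \<xi> \<eta> = (\<Sum>i<bundle_rank A. \<Sum>j<bundle_rank A.
    \<xi> (e i y) * \<eta> (e j y) * P y (coframe A e i y) (coframe A e j y))"
proof -
  have "P y \<xi> \<eta> = - P y \<eta> \<xi>" using bivector_skew assms by blast
  also have "\<dots> = - (\<Sum>i<bundle_rank A. \<xi> (e i y) * P y \<eta> (coframe A e i y))"
    by (subst bivector_expansion[OF assms(1-3,5,4)]) simp
  also have "\<dots> = (\<Sum>i<bundle_rank A. \<xi> (e i y) * P y (coframe A e i y) \<eta>)"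
    using bivector_skew[OF assms(1) coframe_mem[OF assms(2,3)] assms(5)] by (simp add: sum_negf)
  also have "\<dots> = (\<Sum>i<bundle_rank A. \<Sum>j<bundle_rank A.
    \<xi> (e i y) * \<eta> (e j y) * P y (coframe A e i y) (coframe A e j y))"
    by (subst bivector_expansion[OF assms(1-3) coframe_mem[OF assms(2,3)] assms(5)])
      (simp add: sum_distrib_left mult.assoc)
  finally show ?thesis .
qed

text \<open>The description in \<open>sharp\<close> is well posed: the frame vector
  \<open>?v\<close> satisfies it by bilinearity, and covectors separate the points of a
  fibre.\<close>

lemma sharp:
  assumes P: "P \<in> bivectors A" and \<xi>: "\<xi> \<in> dual_fibre A x"
  shows sharp_fibre: "sharp A P x \<xi> \<in> fibre A x"
    and sharp_pairing: "\<eta> \<in> dual_fibre A x \<Longrightarrow> \<eta> (sharp A P x \<xi>) = P x \<xi> \<eta>"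
proof -
  obtain U e where e: "(U, e) \<in> frames A" "x \<in> U" by (rule frame_exists)
  let ?Q = "\<lambda>v. v \<in> fibre A x \<and> (\<forall>\<eta>\<in>dual_fibre A x. \<eta> v = P x \<xi> \<eta>)"
  let ?v = "\<Sum>i<bundle_rank A. P x \<xi> (coframe A e i x) *\<^sub>R e i x"
  have mem: "P x \<xi> (coframe A e i x) *\<^sub>R e i x \<in> fibre A x" if "i < bundle_rank A" for i
    using that by (intro subspace_scale[OF subspace_fibre] frame_mem[OF e])
  have "\<eta> ?v = P x \<xi> \<eta>" if \<eta>: "\<eta> \<in> dual_fibre A x" for \<eta>
  proof -
    have "\<eta> ?v = (\<Sum>i<bundle_rank A. \<eta> (P x \<xi> (coframe A e i x) *\<^sub>R e i x))"
      using mem by (intro dual_fibre_sum[OF \<eta>]) auto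
    also have "\<dots> = (\<Sum>i<bundle_rank A. \<eta> (e i x) * P x \<xi> (coframe A e i x))"
      by (intro sum.cong refl) (simp add: dual_fibre_scale[OF \<eta> frame_mem[OF e]])
    finally show ?thesis by (simp add: bivector_expansion[OF P e \<xi> \<eta>])
  qed
  moreover have "?v \<in> fibre A x" using mem by (intro subspace_sum[OF subspace_fibre]) auto
  ultimately have "?Q ?v" by blast
  moreover have "v = ?v" if "?Q v" for v
    by (rule fibre_eqI) (use that \<open>?Q ?v\<close> in auto)
  ultimately have "?Q (sharp A P x \<xi>)" unfolding sharp_def by (rule theI)
  then show "sharp A P x \<xi> \<in> fibre A x"
    "\<eta> \<in> dual_fibre A x \<Longrightarrow> \<eta> (sharp A P x \<xi>) = P x \<xi> \<eta>" by auto
qed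

lemma sharp_section_mem:
  assumes P: "P \<in> bivectors A" and \<xi>: "\<xi> \<in> dual_sections A"
  shows "sharp_section A P \<xi> \<in> sections A"
proof (rule sectionsI)
  show "sharp_section A P \<xi> x \<in> fibre A x" for x
    unfolding sharp_section_def by (rule sharp_fibre[OF P dual_sections_fibre[OF \<xi>]])
  fix U e i assume e: "(U, e) \<in> frames A" "i < bundle_rank A"
  note op = open_frame[OF e(1)]
  \<comment> \<open>The minus sign comes from moving \<open>\<xi> x\<close> into the second argument
    of \<open>P\<close>, the one that \<open>bivector_expansion\<close> expands.\<close>
  have "smooth U (\<lambda>x. - (\<Sum>j<bundle_rank A. \<xi> x (e j x) * P x (coframe A e i x) (coframe A e j x)))"
    by (intro smooth_minus smooth_sum smooth_mult op dual_sections_smooth[OF \<xi> e(1)]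
        bivector_smooth[OF P e(1)] e(2)) auto
  then show "smooth U (\<lambda>x. coframe A e i x (sharp_section A P \<xi> x))"
  proof (rule smooth_cong[OF op, rotated])
    fix x assume x: "x \<in> U"
    note ci = coframe_mem[OF e(1) x, of i] and \<xi>x = dual_sections_fibre[OF \<xi>, of x]
    have "coframe A e i x (sharp_section A P \<xi> x) = P x (\<xi> x) (coframe A e i x)"
      unfolding sharp_section_def by (rule sharp_pairing[OF P \<xi>x ci])
    also have "\<dots> = - P x (coframe A e i x) (\<xi> x)" by (rule bivector_skew[OF P \<xi>x ci])
    finally show "- (\<Sum>j<bundle_rank A. \<xi> x (e j x) * P x (coframe A e i x) (coframe A e j x))
        = coframe A e i x (sharp_section A P \<xi> x)"
      by (simp add: bivector_expansion[OF P e(1) x ci \<xi>x])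
  qed
qed

lemma decomposition_exists:
  assumes P: "P \<in> bivectors A"
  obtains U ps where "open U" "x \<in> U" "decomposes_on A U P ps"
proof -
  obtain U e where e: "(U, e) \<in> frames A" "x \<in> U" by (rule frame_exists)
  obtain \<theta> V K where \<theta>: "smooth UNIV \<theta>" "open V" "x \<in> V" "\<And>y. y \<in> V \<Longrightarrow> \<theta> y = 1"
    "closed K" "K \<subseteq> U" "\<And>y. y \<notin> K \<Longrightarrow> \<theta> y = 0"
    by (rule bump_function[OF open_frame[OF e(1)] e(2)]) blast
  let ?r = "bundle_rank A"
  define p where "p i j y = P y (coframe A e i y) (coframe A e j y)" for i j y
  \<comment> \<open>The list runs over all ordered pairs \<open>(i, j)\<close>, which counts each
    wedge product of frame vectors twice; hence the factor \<open>1/2\<close>. Together with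
    \<open>Y j\<close> the sum is \<open>\<theta>\<close> squared times \<open>P\<close>, which is
    \<open>P\<close> on \<open>V\<close>.\<close>
  define X where "X i j = (\<lambda>y. (\<theta> y * (p i j y * (1/2))) *\<^sub>R e i y)" for i j
  define Y where "Y j = (\<lambda>y. (\<theta> y * 1) *\<^sub>R e j y)" for j
  define ps where "ps = map (\<lambda>(i, j). (X i j, Y j)) (List.product [0..<?r] [0..<?r])"
  have X: "X i j \<in> sections A" if "i < ?r" "j < ?r" for i j
    unfolding X_def p_def
    by (rule local_section[OF e(1) that(1) _ \<theta>(1,5,6,7)])
      (intro smooth_mult smooth_const open_frame[OF e(1)] bivector_smooth[OF P e(1) that])
  have Y: "Y j \<in> sections A" if "j < ?r" for j
    unfolding Y_def by (rule local_section[OF e(1) that smooth_const \<theta>(1,5,6,7)])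
  have "P y \<xi> \<eta> = (\<Sum>(X, Y)\<leftarrow>ps. wedge2 (X y) (Y y) \<xi> \<eta>)"
    if y: "y \<in> V" and \<xi>: "\<xi> \<in> dual_fibre A y" and \<eta>: "\<eta> \<in> dual_fibre A y" for y \<xi> \<eta>
  proof -
    \<comment> \<open>\<open>\<theta>\<close> is 1 at \<open>y\<close>, so \<open>y\<close> lies in
      \<open>K\<close>, hence in \<open>U\<close>.\<close>
    have yU: "y \<in> U" using y \<theta>(4,6,7) by force
    note sc = dual_fibre_scale[OF \<xi> frame_mem[OF e(1) yU]] dual_fibre_scale[OF \<eta> frame_mem[OF e(1) yU]]
    let ?w = "\<lambda>i j. wedge2 (X i j y) (Y j y) \<xi> \<eta>"
    have "(\<Sum>(X, Y)\<leftarrow>ps. wedge2 (X y) (Y y) \<xi> \<eta>)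
        = (\<Sum>(i, j)\<leftarrow>List.product [0..<?r] [0..<?r]. ?w i j)"
      by (simp add: ps_def comp_def case_prod_unfold)
    also have "\<dots> = (\<Sum>(i, j)\<in>{..<?r} \<times> {..<?r}. ?w i j)"
      by (subst sum_list_distinct_conv_sum_set) (auto simp: distinct_product lessThan_atLeast0 intro!: sum.cong)
    also have "\<dots> = (\<Sum>i<?r. \<Sum>j<?r. ?w i j)" by (simp add: sum.cartesian_product)
    also have "\<dots> = (\<Sum>i<?r. \<Sum>j<?r. (\<xi> (e i y) * \<eta> (e j y) * p i j y) / 2
        - (\<eta> (e i y) * \<xi> (e j y) * p i j y) / 2)"
      by (intro sum.cong) (simp_all add: wedge2_def X_def Y_def \<theta>(4)[OF y] sc field_simps)
    also have "\<dots> = P y \<xi> \<eta> / 2 - P y \<eta> \<xi> / 2"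
      unfolding bivector_expansion2[OF P e(1) yU \<xi> \<eta>] bivector_expansion2[OF P e(1) yU \<eta> \<xi>]
      by (simp add: p_def sum_subtractf sum_divide_distrib)
    also have "\<dots> = P y \<xi> \<eta>" using bivector_skew[OF P \<xi> \<eta>] by simp
    finally show ?thesis by simp
  qed
  moreover have "set ps \<subseteq> sections A \<times> sections A" using X Y by (auto simp: ps_def)
  ultimately have "decomposes_on A V P ps" unfolding decomposes_on_def by blast
  then show thesis using that \<theta>(2,3) by blast
qed

end

section \<open>The Schouten bracket of two bivectors\<close>

locale smooth_algebroid =
  fixes A :: "('m::{t2_space,second_countable_topology}, 'b::real_inner, 'e::real_vector, 'z)
    lie_algebroid_scheme"
  assumes lie_algebroid: "is_lie_algebroid A"
begin

sublocale smooth_bundle A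
  using lie_algebroid unfolding is_lie_algebroid_def by unfold_locales (elim conjE)

lemma bracket_axioms: "lie_bracket_on_sections A (bracket A)"
  and anchor_axioms: "bundle_map_to_tangent A (anchor A)"
  using lie_algebroid unfolding is_lie_algebroid_def by simp_all

section \<open>Calculation rules for the bracket and the anchor\<close>

lemma leibniz:
  assumes "u \<in> sections A" "v \<in> sections A" "smooth UNIV f"
  shows "bracket A u (\<lambda>y. f y *\<^sub>R v y) x = f x *\<^sub>R bracket A u v x + anchor A x (u x) f *\<^sub>R v x"
proof -
  have "\<forall>u\<in>sections A. \<forall>v\<in>sections A. \<forall>f. smooth UNIV f \<longrightarrow>
        (\<forall>x. bracket A u (\<lambda>y. f y *\<^sub>R v y) x =
             f x *\<^sub>R bracket A u v x + anchor A x (u x) f *\<^sub>R v x)"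
    using lie_algebroid unfolding is_lie_algebroid_def by (elim conjE)
  from this[rule_format, OF assms] show ?thesis .
qed

lemma bracket_mem:
  assumes "u \<in> sections A" "v \<in> sections A"
  shows "bracket A u v \<in> sections A"
proof -
  have "\<forall>u\<in>sections A. \<forall>v\<in>sections A. bracket A u v \<in> sections A"
    using bracket_axioms unfolding lie_bracket_on_sections_def by (elim conjE)
  then show ?thesis using assms by blast
qed

lemma bracket_fibre: "u \<in> sections A \<Longrightarrow> v \<in> sections A \<Longrightarrow> bracket A u v x \<in> fibre A x"
  by (rule sections_fibre[OF bracket_mem])

lemma bracket_add:
  assumes "u \<in> sections A" "v \<in> sections A" "w \<in> sections A"
  shows "bracket A (\<lambda>y. u y + v y) w x = bracket A u w x + bracket A v w x"
    and "bracket A w (\<lambda>y. u y + v y) x = bracket A w u x + bracket A w v x"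
proof -
  have "\<forall>u\<in>sections A. \<forall>v\<in>sections A. \<forall>w\<in>sections A. \<forall>x.
        bracket A (\<lambda>y. u y + v y) w x = bracket A u w x + bracket A v w x \<and>
        bracket A w (\<lambda>y. u y + v y) x = bracket A w u x + bracket A w v x"
    using bracket_axioms unfolding lie_bracket_on_sections_def by (elim conjE)
  then show "bracket A (\<lambda>y. u y + v y) w x = bracket A u w x + bracket A v w x"
    "bracket A w (\<lambda>y. u y + v y) x = bracket A w u x + bracket A w v x"
    using assms by simp_all
qed

lemma bracket_minus:
  assumes "u \<in> sections A" "v \<in> sections A"
  shows "bracket A (\<lambda>y. - u y) v x = - bracket A u v x"
    and "bracket A u (\<lambda>y. - v y) x = - bracket A u v x"
proof -
  have *: "\<forall>c. \<forall>u\<in>sections A. \<forall>v\<in>sections A. \<forall>x.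
        bracket A (\<lambda>y. c *\<^sub>R u y) v x = c *\<^sub>R bracket A u v x \<and>
        bracket A u (\<lambda>y. c *\<^sub>R v y) x = c *\<^sub>R bracket A u v x"
    using bracket_axioms unfolding lie_bracket_on_sections_def by (elim conjE)
  show "bracket A (\<lambda>y. - u y) v x = - bracket A u v x"
    "bracket A u (\<lambda>y. - v y) x = - bracket A u v x"
    using *[rule_format, OF assms, of "-1" x] by simp_all
qed

lemma bracket_diff:
  assumes "u \<in> sections A" "v \<in> sections A" "w \<in> sections A"
  shows "bracket A (\<lambda>y. u y - v y) w x = bracket A u w x - bracket A v w x"
    and "bracket A w (\<lambda>y. u y - v y) x = bracket A w u x - bracket A w v x"
  using bracket_add[OF assms(1) sections_uminus[OF assms(2)] assms(3)]
    bracket_minus[OF assms(2,3)] bracket_minus[OF assms(3,2)] by simp_all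

lemma bracket_self:
  assumes "u \<in> sections A"
  shows "bracket A u u x = 0"
proof -
  have "\<forall>u\<in>sections A. \<forall>x. bracket A u u x = 0"
    using bracket_axioms unfolding lie_bracket_on_sections_def by (elim conjE)
  then show ?thesis using assms by blast
qed

lemma bracket_skew:
  assumes "u \<in> sections A" "v \<in> sections A"
  shows "bracket A u v x = - bracket A v u x"
proof -
  have "0 = bracket A (\<lambda>y. u y + v y) (\<lambda>y. u y + v y) x"
    using bracket_self[OF sections_add[OF assms]] by simp
  also have "\<dots> = bracket A v u x + bracket A u v x"
    unfolding bracket_add(1)[OF assms sections_add[OF assms]] bracket_add(2)[OF assms assms(1)]
      bracket_add(2)[OF assms assms(2)]
    using assms by (simp add: bracket_self)
  finally show ?thesis by (simp add: eq_neg_iff_add_eq_0 add.commute)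
qed

text \<open>The Leibniz rule in the second argument, and in the first by skew-symmetry. The minus
  sign sits inside a scalar so that every summand is a multiple of a vector, ready for
  \<open>dual_fibre_scale\<close>.\<close>

lemma bracket_scaled:
  assumes u: "u \<in> sections A" and v: "v \<in> sections A" and f: "smooth UNIV f" and g: "smooth UNIV g"
  shows "bracket A (\<lambda>y. f y *\<^sub>R u y) (\<lambda>y. g y *\<^sub>R v y) x =
    (f x * g x) *\<^sub>R bracket A u v x + (g x * - anchor A x (v x) f) *\<^sub>R u x
      + anchor A x (f x *\<^sub>R u x) g *\<^sub>R v x"
proof -
  note fu = sections_scale[OF f u]
  have "bracket A (\<lambda>y. f y *\<^sub>R u y) v x = - (f x *\<^sub>R bracket A v u x + anchor A x (v x) f *\<^sub>R u x)"
    by (subst bracket_skew[OF fu v]) (simp only: leibniz[OF v u f])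
  also have "\<dots> = f x *\<^sub>R bracket A u v x - anchor A x (v x) f *\<^sub>R u x"
    using bracket_skew[OF u v, of x] by simp
  finally show ?thesis
    by (simp add: leibniz[OF fu v g] scaleR_diff_right mult.commute)
qed

lemma
  assumes "u \<in> fibre A x"
  shows anchor_function_add: "smooth UNIV f \<Longrightarrow> smooth UNIV g \<Longrightarrow>
      anchor A x u (\<lambda>y. f y + g y) = anchor A x u f + anchor A x u g"
    and anchor_function_mult: "smooth UNIV f \<Longrightarrow> smooth UNIV g \<Longrightarrow>
      anchor A x u (\<lambda>y. f y * g y) = f x * anchor A x u g + g x * anchor A x u f"
    and anchor_function_scale: "smooth UNIV f \<Longrightarrow> anchor A x u (\<lambda>y. c * f y) = c * anchor A x u f"
proof -
  have "\<forall>x. \<forall>u\<in>fibre A x. tangent_vector (atlas A) x (anchor A x u)"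
    using anchor_axioms unfolding bundle_map_to_tangent_def by (elim conjE)
  then have "tangent_vector (atlas A) x (anchor A x u)" using assms by blast
  then show "smooth UNIV f \<Longrightarrow> smooth UNIV g \<Longrightarrow>
      anchor A x u (\<lambda>y. f y + g y) = anchor A x u f + anchor A x u g"
    "smooth UNIV f \<Longrightarrow> smooth UNIV g \<Longrightarrow>
      anchor A x u (\<lambda>y. f y * g y) = f x * anchor A x u g + g x * anchor A x u f"
    "smooth UNIV f \<Longrightarrow> anchor A x u (\<lambda>y. c * f y) = c * anchor A x u f"
    unfolding tangent_vector_def by simp_all
qed

lemma anchor_function_diff:
  assumes "u \<in> fibre A x" "smooth UNIV f" "smooth UNIV g"
  shows "anchor A x u (\<lambda>y. f y - g y) = anchor A x u f - anchor A x u g"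
  using anchor_function_add[OF assms(1,2) smooth_mult[OF open_UNIV smooth_const[of _ "-1"] assms(3)]]
    anchor_function_scale[OF assms(1,3), of "-1"] by simp

lemma anchor_linear: "\<forall>x f. smooth UNIV f \<longrightarrow>
        (\<forall>u\<in>fibre A x. \<forall>v\<in>fibre A x. anchor A x (u + v) f = anchor A x u f + anchor A x v f) \<and>
        (\<forall>c. \<forall>u\<in>fibre A x. anchor A x (c *\<^sub>R u) f = c * anchor A x u f)"
  using anchor_axioms unfolding bundle_map_to_tangent_def by (elim conjE)

lemma anchor_add:
  assumes "u \<in> fibre A x" "v \<in> fibre A x" "smooth UNIV f"
  shows "anchor A x (u + v) f = anchor A x u f + anchor A x v f"
  using anchor_linear assms by simp

lemma anchor_scale:
  assumes "u \<in> fibre A x" "smooth UNIV f"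
  shows "anchor A x (c *\<^sub>R u) f = c * anchor A x u f"
  using anchor_linear assms by simp

lemma anchor_diff:
  assumes "u \<in> fibre A x" "v \<in> fibre A x" "smooth UNIV f"
  shows "anchor A x (u - v) f = anchor A x u f - anchor A x v f"
  using anchor_add[OF assms(1) subspace_scale[OF subspace_fibre assms(2), of "-1"] assms(3)]
    anchor_scale[OF assms(2,3), of "-1"] by simp

text \<open>Both locality statements rest on \<open>h = (1 - \<theta>) h\<close> for \<open>h\<close> vanishing near \<open>x\<close> and a bump
  function \<open>\<theta>\<close> at \<open>x\<close>.\<close>

lemma anchor_local:
  assumes u: "u \<in> fibre A x" and f: "smooth UNIV f" and g: "smooth UNIV g"
    and V: "open V" "x \<in> V" "\<And>y. y \<in> V \<Longrightarrow> f y = g y"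
  shows "anchor A x u f = anchor A x u g"
proof -
  obtain \<theta> V' K where \<theta>: "smooth UNIV \<theta>" "open V'" "x \<in> V'" "\<And>y. y \<in> V' \<Longrightarrow> \<theta> y = 1"
    "closed K" "K \<subseteq> V" "\<And>y. y \<notin> K \<Longrightarrow> \<theta> y = 0"
    by (rule bump_function[OF V(1,2)]) blast
  have s: "smooth UNIV (\<lambda>y. 1 - \<theta> y)" "smooth UNIV (\<lambda>y. f y - g y)"
    by (intro smooth_diff smooth_const open_UNIV f g \<theta>(1))+
  have "(\<lambda>y. f y - g y) = (\<lambda>y. (1 - \<theta> y) * (f y - g y))"
  proof
    fix y
    have "y \<in> V \<or> \<theta> y = 0" using \<theta>(6,7) by blast
    then show "f y - g y = (1 - \<theta> y) * (f y - g y)"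
      using V(3)[of y] by auto
  qed
  then have "anchor A x u (\<lambda>y. f y - g y) = anchor A x u (\<lambda>y. (1 - \<theta> y) * (f y - g y))"
    by (rule arg_cong)
  also have "\<dots> = 0"
    unfolding anchor_function_mult[OF u s] using \<theta>(3,4) V(2,3) by simp
  finally show ?thesis by (simp add: anchor_function_diff[OF u f g])
qed

lemma bracket_local:
  assumes w: "w \<in> sections A" and s: "s \<in> sections A" and t: "t \<in> sections A"
    and V: "open V" "x \<in> V" "\<And>y. y \<in> V \<Longrightarrow> s y = t y"
  shows "bracket A w s x = bracket A w t x" "bracket A s w x = bracket A t w x"
proof -
  obtain \<theta> V' K where \<theta>: "smooth UNIV \<theta>" "open V'" "x \<in> V'" "\<And>y. y \<in> V' \<Longrightarrow> \<theta> y = 1"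
    "closed K" "K \<subseteq> V" "\<And>y. y \<notin> K \<Longrightarrow> \<theta> y = 0"
    by (rule bump_function[OF V(1,2)]) blast
  have sm: "smooth UNIV (\<lambda>y. 1 - \<theta> y)"
    by (intro smooth_diff smooth_const open_UNIV \<theta>(1))
  have "(\<lambda>y. s y - t y) = (\<lambda>y. (1 - \<theta> y) *\<^sub>R (s y - t y))"
  proof
    fix y
    have "y \<in> V \<or> \<theta> y = 0" using \<theta>(6,7) by blast
    then show "s y - t y = (1 - \<theta> y) *\<^sub>R (s y - t y)"
      using V(3)[of y] by auto
  qed
  then have "bracket A w (\<lambda>y. s y - t y) x = bracket A w (\<lambda>y. (1 - \<theta> y) *\<^sub>R (s y - t y)) x"
    by (rule arg_cong)
  also have "\<dots> = 0"
    unfolding leibniz[OF w sections_diff[OF s t] sm] using \<theta>(3,4) V(2,3) by simp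
  finally show "bracket A w s x = bracket A w t x" by (simp add: bracket_diff[OF s t w])
  then show "bracket A s w x = bracket A t w x"
    using bracket_skew[OF s w, of x] bracket_skew[OF t w, of x] by simp
qed

text \<open>One of three cyclic summands, for arbitrary maps \<open>p\<close>, \<open>q\<close> on
  sections: this allows a bivector to be replaced by the wedge products of a decomposition one at a
  time.\<close>

definition concomitant_term where
  "concomitant_term p q \<xi> \<eta> \<zeta> x =
     \<zeta> x (bracket A (p \<xi>) (q \<eta>) x) + \<zeta> x (bracket A (q \<xi>) (p \<eta>) x)
     - anchor A x (q \<xi> x) (\<lambda>y. \<zeta> y (p \<eta> y)) - anchor A x (p \<xi> x) (\<lambda>y. \<zeta> y (q \<eta> y))"

text \<open>An expression for \<open>[P, Q](\<xi>, \<eta>, \<zeta>)\<close> in terms of the maps \<open>p\<close>, \<open>q\<close> induced by \<open>P\<close>, \<open>Q\<close> on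
  sections, free of decompositions.\<close>

definition concomitant where
  "concomitant p q \<xi> \<eta> \<zeta> x = concomitant_term p q \<xi> \<eta> \<zeta> x + concomitant_term p q \<eta> \<zeta> \<xi> x
     + concomitant_term p q \<zeta> \<xi> \<eta> x"

lemma concomitant_commute: "concomitant p q \<xi> \<eta> \<zeta> x = concomitant q p \<xi> \<eta> \<zeta> x"
  by (simp add: concomitant_def concomitant_term_def)

text \<open>Arbitrary maps from dual sections to sections; the name reflects the intended instances
  \<open>sharp_section A P\<close> and \<open>wedge_map X Y\<close>.\<close>

abbreviation bundle_maps where
  "bundle_maps \<equiv> dual_sections A \<rightarrow> sections A"

context
  fixes \<xi> \<eta> \<zeta> :: "'m \<Rightarrow> 'e \<Rightarrow> real"
  assumes ds: "\<xi> \<in> dual_sections A" "\<eta> \<in> dual_sections A" "\<zeta> \<in> dual_sections A"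
begin

lemma concomitant_add:
  assumes p: "p \<in> bundle_maps" and p': "p' \<in> bundle_maps" and q: "q \<in> bundle_maps"
  shows "concomitant (\<lambda>\<xi> y. p \<xi> y + p' \<xi> y) q \<xi> \<eta> \<zeta> x
    = concomitant p q \<xi> \<eta> \<zeta> x + concomitant p' q \<xi> \<eta> \<zeta> x"
proof -
  have "concomitant_term (\<lambda>\<xi> y. p \<xi> y + p' \<xi> y) q \<alpha> \<beta> \<gamma> x
    = concomitant_term p q \<alpha> \<beta> \<gamma> x + concomitant_term p' q \<alpha> \<beta> \<gamma> x"
    if d: "\<alpha> \<in> dual_sections A" "\<beta> \<in> dual_sections A" "\<gamma> \<in> dual_sections A" for \<alpha> \<beta> \<gamma>
  proof -
    note m = p[THEN funcset_mem] p'[THEN funcset_mem] q[THEN funcset_mem]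
    note \<gamma> = dual_sections_fibre[OF d(3)]
    have "(\<lambda>y. \<gamma> y (p \<beta> y + p' \<beta> y)) = (\<lambda>y. \<gamma> y (p \<beta> y) + \<gamma> y (p' \<beta> y))"
      by (simp add: dual_fibre_add[OF \<gamma>] sections_fibre m d)
    then show ?thesis
      by (simp add: concomitant_term_def bracket_add dual_fibre_add[OF \<gamma>] bracket_fibre m d
          anchor_add anchor_function_add smooth_pairing sections_fibre)
  qed
  with ds show ?thesis by (simp add: concomitant_def)
qed

lemma concomitant_zero:
  assumes q: "q \<in> bundle_maps"
  shows "concomitant (\<lambda>\<xi> y. 0) q \<xi> \<eta> \<zeta> x = 0"
proof -
  have z: "(\<lambda>\<xi> y. 0) \<in> bundle_maps" using sections_zero by auto
  \<comment> \<open>The zero map is its own sum with itself, so additivity says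
    \<open>r = r + r\<close>.\<close>
  show ?thesis using concomitant_add[OF z z q] by simp
qed

lemma concomitant_sum_list:
  assumes "\<And>z. z \<in> set zs \<Longrightarrow> p z \<in> bundle_maps" and q: "q \<in> bundle_maps"
  shows "(\<lambda>\<xi> y. \<Sum>z\<leftarrow>zs. p z \<xi> y) \<in> bundle_maps"
    and "concomitant (\<lambda>\<xi> y. \<Sum>z\<leftarrow>zs. p z \<xi> y) q \<xi> \<eta> \<zeta> x = (\<Sum>z\<leftarrow>zs. concomitant (p z) q \<xi> \<eta> \<zeta> x)"
proof -
  have "(\<lambda>\<xi> y. \<Sum>z\<leftarrow>zs. p z \<xi> y) \<in> bundle_maps \<and>
    concomitant (\<lambda>\<xi> y. \<Sum>z\<leftarrow>zs. p z \<xi> y) q \<xi> \<eta> \<zeta> x = (\<Sum>z\<leftarrow>zs. concomitant (p z) q \<xi> \<eta> \<zeta> x)"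
    using assms(1)
  proof (induction zs)
    case Nil
    then show ?case by (simp add: concomitant_zero[OF q] sections_zero)
  next
    case (Cons z zs)
    have IH: "(\<lambda>\<xi> y. \<Sum>z\<leftarrow>zs. p z \<xi> y) \<in> bundle_maps"
      "concomitant (\<lambda>\<xi> y. \<Sum>z\<leftarrow>zs. p z \<xi> y) q \<xi> \<eta> \<zeta> x = (\<Sum>z\<leftarrow>zs. concomitant (p z) q \<xi> \<eta> \<zeta> x)"
      using Cons by simp_all
    have z: "p z \<in> bundle_maps" using Cons.prems by simp
    have "(\<lambda>\<xi> y. p z \<xi> y + (\<Sum>z\<leftarrow>zs. p z \<xi> y)) \<in> bundle_maps"
      by (intro Pi_I sections_add z[THEN funcset_mem] IH(1)[THEN funcset_mem])
    then show ?case using concomitant_add[OF z IH(1) q] IH(2) by simp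
  qed
  then show "(\<lambda>\<xi> y. \<Sum>z\<leftarrow>zs. p z \<xi> y) \<in> bundle_maps"
    "concomitant (\<lambda>\<xi> y. \<Sum>z\<leftarrow>zs. p z \<xi> y) q \<xi> \<eta> \<zeta> x = (\<Sum>z\<leftarrow>zs. concomitant (p z) q \<xi> \<eta> \<zeta> x)"
    by auto
qed

text \<open>A decomposition describes \<open>P\<close> only near \<open>x\<close>, while the bracket
  takes global sections. Locality of bracket and anchor closes this gap.\<close>

lemma concomitant_local:
  assumes p: "p \<in> bundle_maps" and p': "p' \<in> bundle_maps" and q: "q \<in> bundle_maps"
    and V: "open V" "x \<in> V" "\<And>\<xi> y. \<xi> \<in> dual_sections A \<Longrightarrow> y \<in> V \<Longrightarrow> p \<xi> y = p' \<xi> y"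
  shows "concomitant p q \<xi> \<eta> \<zeta> x = concomitant p' q \<xi> \<eta> \<zeta> x"
proof -
  have "concomitant_term p q \<alpha> \<beta> \<gamma> x = concomitant_term p' q \<alpha> \<beta> \<gamma> x"
    if d: "\<alpha> \<in> dual_sections A" "\<beta> \<in> dual_sections A" "\<gamma> \<in> dual_sections A" for \<alpha> \<beta> \<gamma>
  proof -
    note m = p[THEN funcset_mem] p'[THEN funcset_mem] q[THEN funcset_mem]
    have "bracket A (p \<alpha>) (q \<beta>) x = bracket A (p' \<alpha>) (q \<beta>) x"
      by (rule bracket_local(2)[OF m(3,1,2) V(1,2)]) (use V d in auto)
    moreover have "bracket A (q \<alpha>) (p \<beta>) x = bracket A (q \<alpha>) (p' \<beta>) x"
      by (rule bracket_local(1)[OF m(3,1,2) V(1,2)]) (use V d in auto)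
    moreover have "anchor A x (q \<alpha> x) (\<lambda>y. \<gamma> y (p \<beta> y)) = anchor A x (q \<alpha> x) (\<lambda>y. \<gamma> y (p' \<beta> y))"
      by (rule anchor_local[OF _ _ _ V(1,2)])
        (use V d in \<open>auto intro!: smooth_pairing m sections_fibre\<close>)
    ultimately show ?thesis using V d by (simp add: concomitant_term_def)
  qed
  with ds show ?thesis by (simp add: concomitant_def)
qed

end

text \<open>The map induced by the bivector \<open>X \<and> Y\<close>, that is, contraction of
  \<open>\<xi>\<close> into its first slot.\<close>

definition wedge_map :: "('m \<Rightarrow> 'e) \<Rightarrow> ('m \<Rightarrow> 'e) \<Rightarrow> ('m \<Rightarrow> 'e \<Rightarrow> real) \<Rightarrow> 'm \<Rightarrow> 'e" where
  "wedge_map X Y \<xi> = (\<lambda>y. \<xi> y (X y) *\<^sub>R Y y - \<xi> y (Y y) *\<^sub>R X y)"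

lemma wedge_map_mem:
  assumes "X \<in> sections A" "Y \<in> sections A"
  shows "wedge_map X Y \<in> bundle_maps"
  unfolding wedge_map_def using assms by (intro Pi_I sections_diff sections_scale smooth_pairing)

lemma pairing_bracket_scaled:
  assumes "\<xi> \<in> dual_sections A" "\<eta> \<in> dual_sections A" "\<zeta> \<in> dual_sections A"
    and "X \<in> sections A" "Y \<in> sections A" "Z \<in> sections A" "W \<in> sections A"
  shows "\<zeta> x (bracket A (\<lambda>y. \<xi> y (X y) *\<^sub>R Y y) (\<lambda>y. \<eta> y (Z y) *\<^sub>R W y) x) =
    \<xi> x (X x) * \<eta> x (Z x) * \<zeta> x (bracket A Y W x)
    - \<eta> x (Z x) * anchor A x (W x) (\<lambda>y. \<xi> y (X y)) * \<zeta> x (Y x)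
    + \<xi> x (X x) * anchor A x (Y x) (\<lambda>y. \<eta> y (Z y)) * \<zeta> x (W x)"
proof -
  note m = sections_fibre[OF assms(5)] sections_fibre[OF assms(7)] bracket_fibre[OF assms(5,7)]
  note sc = subspace_scale[OF subspace_fibre]
  show ?thesis
    by (simp add: bracket_scaled assms smooth_pairing anchor_scale m sc subspace_add[OF subspace_fibre]
        dual_fibre_add[OF dual_sections_fibre[OF assms(3)]]
        dual_fibre_scale[OF dual_sections_fibre[OF assms(3)]] del: scaleR_minus_left scaleR_minus_right
        mult_minus_right)
qed

lemma pairing_bracket_wedge_map:
  assumes ds: "\<xi> \<in> dual_sections A" "\<eta> \<in> dual_sections A" "\<zeta> \<in> dual_sections A"
    and s: "X \<in> sections A" "Y \<in> sections A" "Z \<in> sections A" "W \<in> sections A"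
  shows "\<zeta> x (bracket A (wedge_map X Y \<xi>) (wedge_map Z W \<eta>) x) =
    \<zeta> x (bracket A (\<lambda>y. \<xi> y (X y) *\<^sub>R Y y) (\<lambda>y. \<eta> y (Z y) *\<^sub>R W y) x)
    - \<zeta> x (bracket A (\<lambda>y. \<xi> y (X y) *\<^sub>R Y y) (\<lambda>y. \<eta> y (W y) *\<^sub>R Z y) x)
    - \<zeta> x (bracket A (\<lambda>y. \<xi> y (Y y) *\<^sub>R X y) (\<lambda>y. \<eta> y (Z y) *\<^sub>R W y) x)
    + \<zeta> x (bracket A (\<lambda>y. \<xi> y (Y y) *\<^sub>R X y) (\<lambda>y. \<eta> y (W y) *\<^sub>R Z y) x)"
proof -
  note m = sections_scale[OF smooth_pairing]
  have d: "\<zeta> x (u - v) = \<zeta> x u - \<zeta> x v" if "u \<in> fibre A x" "v \<in> fibre A x" for u v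
    using dual_fibre_add[OF dual_sections_fibre[OF ds(3)] that(1)
        subspace_scale[OF subspace_fibre that(2), of "-1"]]
      dual_fibre_scale[OF dual_sections_fibre[OF ds(3)] that(2), of "-1"] by simp
  show ?thesis
    unfolding wedge_map_def
    by (simp add: bracket_diff m ds s sections_diff d bracket_fibre subspace_diff[OF subspace_fibre])
qed

lemma anchor_wedge_map:
  assumes ds: "\<xi> \<in> dual_sections A" "\<eta> \<in> dual_sections A" "\<zeta> \<in> dual_sections A"
    and s: "X \<in> sections A" "Y \<in> sections A" "Z \<in> sections A" "W \<in> sections A"
  shows "anchor A x (wedge_map Z W \<xi> x) (\<lambda>y. \<zeta> y (wedge_map X Y \<eta> y)) =
    \<xi> x (Z x) *
      (\<eta> x (X x) * anchor A x (W x) (\<lambda>y. \<zeta> y (Y y)) + \<zeta> x (Y x) * anchor A x (W x) (\<lambda>y. \<eta> y (X y))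
      - \<eta> x (Y x) * anchor A x (W x) (\<lambda>y. \<zeta> y (X y)) - \<zeta> x (X x) * anchor A x (W x) (\<lambda>y. \<eta> y (Y y)))
    - \<xi> x (W x) *
      (\<eta> x (X x) * anchor A x (Z x) (\<lambda>y. \<zeta> y (Y y)) + \<zeta> x (Y x) * anchor A x (Z x) (\<lambda>y. \<eta> y (X y))
      - \<eta> x (Y x) * anchor A x (Z x) (\<lambda>y. \<zeta> y (X y)) - \<zeta> x (X x) * anchor A x (Z x) (\<lambda>y. \<eta> y (Y y)))"
proof -
  have d: "\<zeta> y (a *\<^sub>R u - b *\<^sub>R v) = a * \<zeta> y u - b * \<zeta> y v"
    if "u \<in> fibre A y" "v \<in> fibre A y" for a b y u v
    using dual_fibre_add[OF dual_sections_fibre[OF ds(3)] subspace_scale[OF subspace_fibre that(1)]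
        subspace_scale[OF subspace_fibre that(2)], of a "-b"]
      dual_fibre_scale[OF dual_sections_fibre[OF ds(3)] that(1), of a]
      dual_fibre_scale[OF dual_sections_fibre[OF ds(3)] that(2), of "-b"] by simp
  have "(\<lambda>y. \<zeta> y (wedge_map X Y \<eta> y)) = (\<lambda>y. \<eta> y (X y) * \<zeta> y (Y y) - \<eta> y (Y y) * \<zeta> y (X y))"
    unfolding wedge_map_def by (simp add: d sections_fibre s)
  moreover have "anchor A x (W' x) (\<lambda>y. \<eta> y (X y) * \<zeta> y (Y y) - \<eta> y (Y y) * \<zeta> y (X y)) =
      \<eta> x (X x) * anchor A x (W' x) (\<lambda>y. \<zeta> y (Y y)) + \<zeta> x (Y x) * anchor A x (W' x) (\<lambda>y. \<eta> y (X y))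
      - \<eta> x (Y x) * anchor A x (W' x) (\<lambda>y. \<zeta> y (X y)) - \<zeta> x (X x) * anchor A x (W' x) (\<lambda>y. \<eta> y (Y y))"
    if "W' \<in> sections A" for W'
    by (simp add: anchor_function_diff anchor_function_mult smooth_mult smooth_pairing ds s
        sections_fibre[OF that])
  moreover have "anchor A x (wedge_map Z W \<xi> x) f = \<xi> x (Z x) * anchor A x (W x) f - \<xi> x (W x) * anchor A x (Z x) f"
    if "smooth UNIV f" for f
    unfolding wedge_map_def
    by (simp add: anchor_diff anchor_scale that sections_fibre s subspace_scale[OF subspace_fibre])
  moreover have "smooth UNIV (\<lambda>y. \<eta> y (X y) * \<zeta> y (Y y) - \<eta> y (Y y) * \<zeta> y (X y))"
    by (intro smooth_diff smooth_mult smooth_pairing open_UNIV ds s)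
  ultimately show ?thesis by (simp add: s)
qed

text \<open>In the cyclic sum the derivatives produced by the Leibniz rule cancel those of the
  explicit anchor terms. What remains are covectors applied to the four brackets, weighted by
  pairings, and these assemble into the expansions of \<open>wedge3\<close>.\<close>

lemma concomitant_wedge_map:
  assumes ds: "\<xi> \<in> dual_sections A" "\<eta> \<in> dual_sections A" "\<zeta> \<in> dual_sections A"
    and s: "X \<in> sections A" "Y \<in> sections A" "Z \<in> sections A" "W \<in> sections A"
  shows "concomitant (wedge_map X Y) (wedge_map Z W) \<xi> \<eta> \<zeta> x
    = schouten_decomposable A X Y Z W x (\<xi> x) (\<eta> x) (\<zeta> x)"
proof -
  \<comment> \<open>\<open>concomitant_term\<close> contains both orders of the two maps, while
    \<open>schouten_decomposable\<close> has \<open>X\<close>, \<open>Y\<close> on the left of every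
    bracket.\<close>
  have skew: "\<alpha> x (bracket A u v x) = - \<alpha> x (bracket A v u x)"
    if "\<alpha> \<in> dual_sections A" "u \<in> sections A" "v \<in> sections A" for \<alpha> u v
    using dual_fibre_scale[OF dual_sections_fibre[OF that(1)] bracket_fibre[OF that(3,2)], of x "-1"]
      bracket_skew[OF that(2,3), of x] by simp
  have sk: "\<alpha> x (bracket A Z X x) = - \<alpha> x (bracket A X Z x)"
    "\<alpha> x (bracket A W X x) = - \<alpha> x (bracket A X W x)"
    "\<alpha> x (bracket A Z Y x) = - \<alpha> x (bracket A Y Z x)"
    "\<alpha> x (bracket A W Y x) = - \<alpha> x (bracket A Y W x)" if "\<alpha> \<in> dual_sections A" for \<alpha>
    by (rule skew[OF that]; rule s)+
  show ?thesis
    unfolding concomitant_def concomitant_term_def schouten_decomposable_def wedge3_def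
    by (simp add: pairing_bracket_wedge_map anchor_wedge_map ds s)
      (simp add: pairing_bracket_scaled ds s sk, simp add: algebra_simps)
qed

lemma sharp_section_decomposition:
  assumes P: "P \<in> bivectors A" and dec: "decomposes_on A U P ps" and y: "y \<in> U"
    and \<xi>: "\<xi> \<in> dual_sections A"
  shows "sharp_section A P \<xi> y = (\<Sum>(X, Y)\<leftarrow>ps. wedge_map X Y \<xi> y)"
proof (rule fibre_eqI)
  note \<xi>y = dual_sections_fibre[OF \<xi>, of y]
  show "sharp_section A P \<xi> y \<in> fibre A y"
    by (rule sections_fibre[OF sharp_section_mem[OF P \<xi>]])
  have "set ps \<subseteq> sections A \<times> sections A" using dec by (simp add: decomposes_on_def)
  then have *: "(\<Sum>(X, Y)\<leftarrow>ps. wedge_map X Y \<xi> y) \<in> fibre A y \<and>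
     (\<forall>\<eta>\<in>dual_fibre A y. \<eta> (\<Sum>(X, Y)\<leftarrow>ps. wedge_map X Y \<xi> y)
       = (\<Sum>(X, Y)\<leftarrow>ps. wedge2 (X y) (Y y) (\<xi> y) \<eta>))"
  proof (induction ps)
    case Nil
    then show ?case by (simp add: dual_fibre_zero subspace_0[OF subspace_fibre])
  next
    case (Cons z ps)
    obtain X Y where z: "z = (X, Y)" by (cases z)
    have XY: "X \<in> sections A" "Y \<in> sections A" using Cons.prems z by auto
    have IH: "(\<Sum>(X, Y)\<leftarrow>ps. wedge_map X Y \<xi> y) \<in> fibre A y"
      "\<And>\<eta>. \<eta> \<in> dual_fibre A y \<Longrightarrow> \<eta> (\<Sum>(X, Y)\<leftarrow>ps. wedge_map X Y \<xi> y)
       = (\<Sum>(X, Y)\<leftarrow>ps. wedge2 (X y) (Y y) (\<xi> y) \<eta>)"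
      using Cons by auto
    have mem: "wedge_map X Y \<xi> y \<in> fibre A y"
      by (rule sections_fibre[OF funcset_mem[OF wedge_map_mem[OF XY] \<xi>]])
    have "\<eta> (wedge_map X Y \<xi> y) = wedge2 (X y) (Y y) (\<xi> y) \<eta>" if \<eta>: "\<eta> \<in> dual_fibre A y" for \<eta>
      using dual_fibre_add[OF \<eta> subspace_scale[OF subspace_fibre sections_fibre[OF XY(2)]]
        subspace_scale[OF subspace_fibre sections_fibre[OF XY(1)]], of "\<xi> y (X y)" "- \<xi> y (Y y)"]
        dual_fibre_scale[OF \<eta> sections_fibre[OF XY(2)], of "\<xi> y (X y)"]
        dual_fibre_scale[OF \<eta> sections_fibre[OF XY(1)], of "- \<xi> y (Y y)"]
      by (simp add: wedge_map_def wedge2_def)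
    then show ?case
      using IH mem by (simp add: z dual_fibre_add subspace_add[OF subspace_fibre])
  qed
  then show "(\<Sum>(X, Y)\<leftarrow>ps. wedge_map X Y \<xi> y) \<in> fibre A y" by blast
  fix \<eta> assume \<eta>: "\<eta> \<in> dual_fibre A y"
  have "\<eta> (sharp_section A P \<xi> y) = P y (\<xi> y) \<eta>"
    unfolding sharp_section_def by (rule sharp_pairing[OF P \<xi>y \<eta>])
  also have "\<dots> = (\<Sum>(X, Y)\<leftarrow>ps. wedge2 (X y) (Y y) (\<xi> y) \<eta>)"
    using dec y \<xi>y \<eta> unfolding decomposes_on_def by blast
  finally show "\<eta> (sharp_section A P \<xi> y) = \<eta> (\<Sum>(X, Y)\<leftarrow>ps. wedge_map X Y \<xi> y)"
    using * \<eta> by simp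
qed

text \<open>Near \<open>x\<close> the induced map is a sum of wedge maps; locality passes to that
  sum and additivity splits it.\<close>

lemma concomitant_decomposition:
  assumes P: "P \<in> bivectors A" and q: "q \<in> bundle_maps"
    and dec: "open U" "x \<in> U" "decomposes_on A U P ps"
    and ds: "\<xi> \<in> dual_sections A" "\<eta> \<in> dual_sections A" "\<zeta> \<in> dual_sections A"
  shows "concomitant (sharp_section A P) q \<xi> \<eta> \<zeta> x
    = (\<Sum>(X, Y)\<leftarrow>ps. concomitant (wedge_map X Y) q \<xi> \<eta> \<zeta> x)"
proof -
  let ?w = "\<lambda>z. wedge_map (fst z) (snd z)"
  have "set ps \<subseteq> sections A \<times> sections A" using dec(3) by (simp add: decomposes_on_def)
  then have m: "?w z \<in> bundle_maps" if "z \<in> set ps" for z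
    using that by (intro wedge_map_mem) auto
  have "concomitant (sharp_section A P) q \<xi> \<eta> \<zeta> x = concomitant (\<lambda>\<xi> y. \<Sum>z\<leftarrow>ps. ?w z \<xi> y) q \<xi> \<eta> \<zeta> x"
    using sharp_section_mem[OF P] sharp_section_decomposition[OF P dec(3)]
    by (intro concomitant_local[OF ds _ concomitant_sum_list(1)[OF ds m q] q dec(1,2)])
      (auto simp: case_prod_unfold)
  also have "\<dots> = (\<Sum>z\<leftarrow>ps. concomitant (?w z) q \<xi> \<eta> \<zeta> x)"
    by (rule concomitant_sum_list(2)[OF ds m q])
  finally show ?thesis by (simp add: case_prod_unfold)
qed

text \<open>The right side knows nothing of decompositions, so every choice yields the same number
  and the description in \<open>schouten\<close> is well posed. The left side knows only the values
  at \<open>x\<close>, so the concomitant of two bivectors is tensorial.\<close>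

proposition schouten_eq_concomitant:
  assumes P: "P \<in> bivectors A" and Q: "Q \<in> bivectors A"
    and ds: "\<xi> \<in> dual_sections A" "\<eta> \<in> dual_sections A" "\<zeta> \<in> dual_sections A"
  shows "schouten A P Q x (\<xi> x) (\<eta> x) (\<zeta> x)
    = concomitant (sharp_section A P) (sharp_section A Q) \<xi> \<eta> \<zeta> x"
proof -
  have *: "(\<Sum>(X, Y)\<leftarrow>ps. \<Sum>(Z, W)\<leftarrow>qs. schouten_decomposable A X Y Z W x (\<xi> x) (\<eta> x) (\<zeta> x))
    = concomitant (sharp_section A P) (sharp_section A Q) \<xi> \<eta> \<zeta> x"
    if U: "open U" "x \<in> U" and dP: "decomposes_on A U P ps" and dQ: "decomposes_on A U Q qs" for U ps qs
  proof -
    have mem: "set ps \<subseteq> sections A \<times> sections A" "set qs \<subseteq> sections A \<times> sections A"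
      using dP dQ by (simp_all add: decomposes_on_def)
    have "concomitant (wedge_map X Y) (sharp_section A Q) \<xi> \<eta> \<zeta> x
      = (\<Sum>(Z, W)\<leftarrow>qs. schouten_decomposable A X Y Z W x (\<xi> x) (\<eta> x) (\<zeta> x))"
      if XY: "(X, Y) \<in> set ps" for X Y
    proof -
      have s: "X \<in> sections A" "Y \<in> sections A" using mem XY by auto
      have "concomitant (wedge_map X Y) (sharp_section A Q) \<xi> \<eta> \<zeta> x
        = (\<Sum>(Z, W)\<leftarrow>qs. concomitant (wedge_map Z W) (wedge_map X Y) \<xi> \<eta> \<zeta> x)"
        \<comment> \<open>Symmetry brings \<open>Q\<close> into the first slot, where it can be
          decomposed.\<close>
        by (subst concomitant_commute)
          (rule concomitant_decomposition[OF Q wedge_map_mem[OF s] U dQ ds])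
      also have "\<dots> = (\<Sum>(Z, W)\<leftarrow>qs. schouten_decomposable A X Y Z W x (\<xi> x) (\<eta> x) (\<zeta> x))"
      proof (rule arg_cong[where f = sum_list], rule map_cong[OF refl], clarify)
        fix Z W assume "(Z, W) \<in> set qs"
        then have "Z \<in> sections A" "W \<in> sections A" using mem by auto
        then show "concomitant (wedge_map Z W) (wedge_map X Y) \<xi> \<eta> \<zeta> x
          = schouten_decomposable A X Y Z W x (\<xi> x) (\<eta> x) (\<zeta> x)"
          using concomitant_wedge_map[OF ds s] concomitant_commute by metis
      qed
      finally show ?thesis .
    qed
    then have "(\<Sum>(X, Y)\<leftarrow>ps. concomitant (wedge_map X Y) (sharp_section A Q) \<xi> \<eta> \<zeta> x)
      = (\<Sum>(X, Y)\<leftarrow>ps. \<Sum>(Z, W)\<leftarrow>qs. schouten_decomposable A X Y Z W x (\<xi> x) (\<eta> x) (\<zeta> x))"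
      by (intro arg_cong[where f = sum_list] map_cong refl) auto
    moreover have "sharp_section A Q \<in> bundle_maps" using sharp_section_mem[OF Q] by blast
    ultimately show ?thesis using concomitant_decomposition[OF P _ U dP ds] by simp
  qed
  obtain U ps where U: "open U" "x \<in> U" "decomposes_on A U P ps"
    by (rule decomposition_exists[OF P])
  obtain V qs where V: "open V" "x \<in> V" "decomposes_on A V Q qs"
    by (rule decomposition_exists[OF Q])
  \<comment> \<open>\<open>schouten\<close> asks for a single neighbourhood serving both
    decompositions.\<close>
  have UV: "open (U \<inter> V)" "x \<in> U \<inter> V" "decomposes_on A (U \<inter> V) P ps" "decomposes_on A (U \<inter> V) Q qs"
    using U V by (auto simp: decomposes_on_def)
  show ?thesis
    unfolding schouten_def
  proof (rule the_equality)
    show "\<exists>U ps qs. open U \<and> x \<in> U \<and> decomposes_on A U P ps \<and> decomposes_on A U Q qs \<and>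
      concomitant (sharp_section A P) (sharp_section A Q) \<xi> \<eta> \<zeta> x =
      (\<Sum>(X, Y)\<leftarrow>ps. \<Sum>(Z, W)\<leftarrow>qs. schouten_decomposable A X Y Z W x (\<xi> x) (\<eta> x) (\<zeta> x))"
      using UV *[OF UV] by metis
  qed (use * in auto)
qed

text \<open>Only values at \<open>x\<close> matter, so one convenient extension of each covector
  suffices. The converse direction will extend \<open>c\<close> by the middle member of a
  chain.\<close>

lemma poisson_bivectorI:
  assumes P: "P \<in> bivectors A"
    and conc: "\<And>x a b c. a \<in> dual_fibre A x \<Longrightarrow> b \<in> dual_fibre A x \<Longrightarrow> c \<in> dual_fibre A x \<Longrightarrow>
      \<exists>\<xi>\<in>dual_sections A. \<exists>\<eta>\<in>dual_sections A. \<exists>\<zeta>\<in>dual_sections A. \<xi> x = a \<and> \<eta> x = b \<and> \<zeta> x = c \<and>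
        concomitant (sharp_section A P) (sharp_section A P) \<xi> \<eta> \<zeta> x = 0"
  shows "poisson_bivector A P"
  unfolding poisson_bivector_def
proof (intro conjI P allI ballI)
  fix x a b c assume "a \<in> dual_fibre A x" "b \<in> dual_fibre A x" "c \<in> dual_fibre A x"
  from conc[OF this] obtain \<xi> \<eta> \<zeta> where
    "\<xi> \<in> dual_sections A" "\<eta> \<in> dual_sections A" "\<zeta> \<in> dual_sections A"
    "\<xi> x = a" "\<eta> x = b" "\<zeta> x = c" "concomitant (sharp_section A P) (sharp_section A P) \<xi> \<eta> \<zeta> x = 0"
    by blast
  then show "schouten A P P x a b c = 0"
    using schouten_eq_concomitant[OF P P, of \<xi> \<eta> \<zeta> x] by simp
qed

lemma poisson_concomitant:
  assumes "poisson_bivector A P"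
    and ds: "\<xi> \<in> dual_sections A" "\<eta> \<in> dual_sections A" "\<zeta> \<in> dual_sections A"
  shows "concomitant (sharp_section A P) (sharp_section A P) \<xi> \<eta> \<zeta> x = 0"
proof -
  have P: "P \<in> bivectors A" using assms(1) by (simp add: poisson_bivector_def)
  have "schouten A P P x (\<xi> x) (\<eta> x) (\<zeta> x) = 0"
    using assms(1) ds[THEN dual_sections_fibre] by (simp add: poisson_bivector_def)
  then show ?thesis using schouten_eq_concomitant[OF P P ds] by simp
qed

end

section \<open>The torsion of the relation of a pair\<close>

context smooth_algebroid
begin

lemma sharp_section_pairing:
  assumes "P \<in> bivectors A" "\<xi> \<in> dual_sections A" "\<eta> \<in> dual_sections A"
  shows "\<eta> x (sharp_section A P \<xi> x) = P x (\<xi> x) (\<eta> x)"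
  unfolding sharp_section_def by (rule sharp_pairing[OF assms(1) assms(2,3)[THEN dual_sections_fibre]])

text \<open>On the right, \<open>images\<close> cancels the brackets and anchor directions involving
  \<open>p \<alpha>\<close> and \<open>q \<alpha>''\<close> against those involving
  \<open>q \<alpha>'\<close> and \<open>p \<alpha>'\<close>, and \<open>chain\<close> cancels the
  derivatives of pairings along \<open>p \<xi>\<close> and \<open>q \<xi>\<close>, as well as those
  along \<open>p \<eta>\<close> and \<open>q \<eta>\<close>. Only the torsion survives.\<close>

lemma torsion_eq_concomitant:
  assumes maps: "p \<in> bundle_maps" "q \<in> bundle_maps"
    and ds: "\<xi> \<in> dual_sections A" "\<eta> \<in> dual_sections A" "\<alpha>' \<in> dual_sections A"
    and chain: "\<And>\<xi> y. \<xi> \<in> dual_sections A \<Longrightarrow> \<alpha>' y (q \<xi> y) = \<alpha> y (p \<xi> y)"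
      "\<And>\<xi> y. \<xi> \<in> dual_sections A \<Longrightarrow> \<alpha>'' y (q \<xi> y) = \<alpha>' y (p \<xi> y)"
    and images: "p \<alpha> = q \<alpha>'" "p \<alpha>' = q \<alpha>''"
  shows "\<alpha> x (bracket A (p \<xi>) (p \<eta>) x)
      - \<alpha>' x (bracket A (p \<xi>) (q \<eta>) x + bracket A (q \<xi>) (p \<eta>) x)
      + \<alpha>'' x (bracket A (q \<xi>) (q \<eta>) x)
    = concomitant p p \<xi> \<eta> \<alpha> x / 2 + concomitant q q \<xi> \<eta> \<alpha>'' x / 2 - concomitant p q \<xi> \<eta> \<alpha>' x"
proof -
  note m = maps[THEN funcset_mem]
  \<comment> \<open>Equality as functions, because the anchor differentiates these pairings.\<close>
  have "(\<lambda>y. \<alpha> y (p \<xi> y)) = (\<lambda>y. \<alpha>' y (q \<xi> y))" "(\<lambda>y. \<alpha>'' y (q \<xi> y)) = (\<lambda>y. \<alpha>' y (p \<xi> y))"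
    if "\<xi> \<in> dual_sections A" for \<xi>
    by (simp_all add: chain that)
  then show ?thesis
    by (simp add: concomitant_def concomitant_term_def ds images m add_divide_distrib diff_divide_distrib
        dual_fibre_add[OF dual_sections_fibre[OF ds(3)] bracket_fibre bracket_fibre])
qed

text \<open>Membership in the dual relation reads
  \<open>P(\<xi>, \<alpha>) = P'(\<xi>, \<alpha>')\<close>. Skew-symmetry moves \<open>\<xi>\<close>
  to the second slot, and sections \<open>\<xi>\<close> reach every covector at
  \<open>y\<close>.\<close>

lemma sharp_sections_eq:
  assumes P: "P \<in> bivectors A" "P' \<in> bivectors A"
    and ds: "\<alpha> \<in> dual_sections A" "\<alpha>' \<in> dual_sections A"
    and rel: "\<And>\<xi> y. \<xi> \<in> dual_sections A \<Longrightarrow> \<alpha>' y (sharp_section A P' \<xi> y) = \<alpha> y (sharp_section A P \<xi> y)"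
  shows "sharp_section A P \<alpha> = sharp_section A P' \<alpha>'"
proof
  fix y
  show "sharp_section A P \<alpha> y = sharp_section A P' \<alpha>' y"
  proof (rule fibre_eqI)
    show "sharp_section A P \<alpha> y \<in> fibre A y" "sharp_section A P' \<alpha>' y \<in> fibre A y"
      by (rule sections_fibre[OF sharp_section_mem[OF P(1) ds(1)]],
          rule sections_fibre[OF sharp_section_mem[OF P(2) ds(2)]])
    fix c assume c: "c \<in> dual_fibre A y"
    obtain \<xi> where \<xi>: "\<xi> \<in> dual_sections A" "\<xi> y = c" by (rule dual_section_through[OF c])
    have "P y (\<xi> y) (\<alpha> y) = P' y (\<xi> y) (\<alpha>' y)"
      using rel[OF \<xi>(1), of y] by (simp add: sharp_section_pairing P ds \<xi>(1))
    then have "P y (\<alpha> y) (\<xi> y) = P' y (\<alpha>' y) (\<xi> y)"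
      using bivector_skew[OF P(1), of "\<alpha> y" y "\<xi> y"] bivector_skew[OF P(2), of "\<alpha>' y" y "\<xi> y"]
      by (simp add: dual_sections_fibre ds \<xi>(1))
    then show "c (sharp_section A P \<alpha> y) = c (sharp_section A P' \<alpha>' y)"
      unfolding \<xi>(2)[symmetric] by (simp add: sharp_section_pairing P ds \<xi>(1))
  qed
qed

lemma dual_pair_relation_iff:
  "(\<beta>, \<alpha>) \<in> dual_relation A (pair_relation A P P') \<longleftrightarrow> \<beta> \<in> dual_sections A \<and> \<alpha> \<in> dual_sections A \<and>
    (\<forall>\<xi>\<in>dual_sections A. \<forall>y. \<alpha> y (sharp_section A P' \<xi> y) = \<beta> y (sharp_section A P \<xi> y))"
  unfolding dual_relation_def pair_relation_def by blast

lemma pair_torsion: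
  assumes P: "poisson_bivector A P" "poisson_bivector A P'"
    and ds: "\<xi> \<in> dual_sections A" "\<eta> \<in> dual_sections A"
    and chain: "(\<alpha>, \<alpha>') \<in> dual_relation A (pair_relation A P P')"
      "(\<alpha>', \<alpha>'') \<in> dual_relation A (pair_relation A P P')"
  shows "\<alpha> x (bracket A (sharp_section A P \<xi>) (sharp_section A P \<eta>) x)
      - \<alpha>' x (bracket A (sharp_section A P \<xi>) (sharp_section A P' \<eta>) x
        + bracket A (sharp_section A P' \<xi>) (sharp_section A P \<eta>) x)
      + \<alpha>'' x (bracket A (sharp_section A P' \<xi>) (sharp_section A P' \<eta>) x)
    = - concomitant (sharp_section A P) (sharp_section A P') \<xi> \<eta> \<alpha>' x"
proof -
  have biv: "P \<in> bivectors A" "P' \<in> bivectors A" using P by (simp_all add: poisson_bivector_def)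
  have maps: "sharp_section A P \<in> bundle_maps" "sharp_section A P' \<in> bundle_maps"
    using biv sharp_section_mem by auto
  have \<alpha>: "\<alpha> \<in> dual_sections A" "\<alpha>' \<in> dual_sections A" "\<alpha>'' \<in> dual_sections A"
    and rel: "\<And>\<xi> y. \<xi> \<in> dual_sections A \<Longrightarrow> \<alpha>' y (sharp_section A P' \<xi> y) = \<alpha> y (sharp_section A P \<xi> y)"
      "\<And>\<xi> y. \<xi> \<in> dual_sections A \<Longrightarrow> \<alpha>'' y (sharp_section A P' \<xi> y) = \<alpha>' y (sharp_section A P \<xi> y)"
    using chain by (simp_all add: dual_pair_relation_iff)
  have images: "sharp_section A P \<alpha> = sharp_section A P' \<alpha>'" "sharp_section A P \<alpha>' = sharp_section A P' \<alpha>''"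
    by (rule sharp_sections_eq[OF biv \<alpha>(1,2) rel(1)], assumption)
      (rule sharp_sections_eq[OF biv \<alpha>(2,3) rel(2)])
  show ?thesis
    using torsion_eq_concomitant[OF maps ds \<alpha>(2) rel images, of x]
      poisson_concomitant[OF P(1) ds \<alpha>(1), of x] poisson_concomitant[OF P(2) ds \<alpha>(3), of x] by simp
qed

lemma pair_relation_sections:
  assumes "P \<in> bivectors A" "P' \<in> bivectors A"
  shows "pair_relation A P P' \<subseteq> sections A \<times> sections A"
  using assms by (auto simp: pair_relation_def sharp_section_mem)

section \<open>Sums of bivectors and the two implications\<close>

lemma sum_mem_bivectors:
  assumes P: "P \<in> bivectors A" and P': "P' \<in> bivectors A"
  shows "(\<lambda>x \<xi> \<eta>. P x \<xi> \<eta> + P' x \<xi> \<eta>) \<in> bivectors A"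
proof -
  have "smooth U (\<lambda>x. P x (coframe A e i x) (coframe A e j x) + P' x (coframe A e i x) (coframe A e j x))"
    if "(U, e) \<in> frames A" "i < bundle_rank A" "j < bundle_rank A" for U e i j
    using that by (intro smooth_add open_frame bivector_smooth P P')
  then have "\<forall>(U, e)\<in>frames A. \<forall>i<bundle_rank A. \<forall>j<bundle_rank A.
    smooth U (\<lambda>x. P x (coframe A e i x) (coframe A e j x) + P' x (coframe A e i x) (coframe A e j x))"
    by blast
  moreover have "(P x \<xi> \<xi> + P' x \<xi> \<xi> = 0) \<and>
        (\<forall>\<eta>\<in>dual_fibre A x.
           (\<forall>\<zeta>\<in>dual_fibre A x.
              P x (\<lambda>u. \<xi> u + \<eta> u) \<zeta> + P' x (\<lambda>u. \<xi> u + \<eta> u) \<zeta> = (P x \<xi> \<zeta> + P' x \<xi> \<zeta>) + (P x \<eta> \<zeta> + P' x \<eta> \<zeta>) \<and>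
              P x \<zeta> (\<lambda>u. \<xi> u + \<eta> u) + P' x \<zeta> (\<lambda>u. \<xi> u + \<eta> u) = (P x \<zeta> \<xi> + P' x \<zeta> \<xi>) + (P x \<zeta> \<eta> + P' x \<zeta> \<eta>)) \<and>
           (\<forall>c. P x (\<lambda>u. c * \<xi> u) \<eta> + P' x (\<lambda>u. c * \<xi> u) \<eta> = c * (P x \<xi> \<eta> + P' x \<xi> \<eta>) \<and>
              P x \<eta> (\<lambda>u. c * \<xi> u) + P' x \<eta> (\<lambda>u. c * \<xi> u) = c * (P x \<eta> \<xi> + P' x \<eta> \<xi>)))"
    if \<xi>: "\<xi> \<in> dual_fibre A x" for x \<xi>
    by (simp add: bivector_alternating[OF P \<xi>] bivector_alternating[OF P' \<xi>] bivector_add[OF P \<xi>]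
        bivector_add[OF P' \<xi>] bivector_scale[OF P \<xi>] bivector_scale[OF P' \<xi>] distrib_left)
  ultimately show ?thesis unfolding bivectors_def by simp
qed

lemma sharp_section_sum:
  assumes P: "P \<in> bivectors A" and P': "P' \<in> bivectors A" and \<xi>: "\<xi> \<in> dual_sections A"
  shows "sharp_section A (\<lambda>x \<xi> \<eta>. P x \<xi> \<eta> + P' x \<xi> \<eta>) \<xi> = (\<lambda>y. sharp_section A P \<xi> y + sharp_section A P' \<xi> y)"
proof
  fix y
  note \<xi>y = dual_sections_fibre[OF \<xi>, of y]
  note mem = sharp_fibre[OF P \<xi>y] sharp_fibre[OF P' \<xi>y]
  show "sharp_section A (\<lambda>x \<xi> \<eta>. P x \<xi> \<eta> + P' x \<xi> \<eta>) \<xi> y = sharp_section A P \<xi> y + sharp_section A P' \<xi> y"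
    unfolding sharp_section_def
  proof (rule fibre_eqI)
    fix \<eta> assume \<eta>: "\<eta> \<in> dual_fibre A y"
    show "\<eta> (sharp A (\<lambda>x \<xi> \<eta>. P x \<xi> \<eta> + P' x \<xi> \<eta>) y (\<xi> y)) = \<eta> (sharp A P y (\<xi> y) + sharp A P' y (\<xi> y))"
      by (simp add: dual_fibre_add[OF \<eta> mem] sharp_pairing[OF P \<xi>y \<eta>] sharp_pairing[OF P' \<xi>y \<eta>]
          sharp_pairing[OF sum_mem_bivectors[OF P P'] \<xi>y \<eta>])
  qed (intro sharp_fibre sum_mem_bivectors P P' \<xi>y subspace_add[OF subspace_fibre])+
qed

text \<open>Polarisation of a symmetric biadditive expression. It links the Poisson condition on the
  sum, by which \<open>hamiltonian_pair\<close> is defined, to the mixed bracket.\<close>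

lemma concomitant_bivector_sum:
  assumes P: "P \<in> bivectors A" and P': "P' \<in> bivectors A"
    and ds: "\<xi> \<in> dual_sections A" "\<eta> \<in> dual_sections A" "\<zeta> \<in> dual_sections A"
  defines "S \<equiv> sharp_section A (\<lambda>x \<xi> \<eta>. P x \<xi> \<eta> + P' x \<xi> \<eta>)"
  shows "concomitant S S \<xi> \<eta> \<zeta> x =
    concomitant (sharp_section A P) (sharp_section A P) \<xi> \<eta> \<zeta> x
    + concomitant (sharp_section A P') (sharp_section A P') \<xi> \<eta> \<zeta> x
    + 2 * concomitant (sharp_section A P) (sharp_section A P') \<xi> \<eta> \<zeta> x"
proof -
  let ?p = "sharp_section A P" and ?q = "sharp_section A P'"
  define T where "T = (\<lambda>\<xi> y. ?p \<xi> y + ?q \<xi> y)"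
  have maps: "?p \<in> bundle_maps" "?q \<in> bundle_maps"
    using sharp_section_mem[OF P] sharp_section_mem[OF P'] by auto
  have "S \<xi> = T \<xi>" if "\<xi> \<in> dual_sections A" for \<xi>
    using sharp_section_sum[OF P P' that] by (simp add: S_def T_def)
  \<comment> \<open>\<open>S\<close> and \<open>T\<close> are known to agree on dual sections only,
    so the definition is unfolded instead of rewriting \<open>S\<close> by \<open>T\<close>.\<close>
  then have "concomitant S S \<xi> \<eta> \<zeta> x = concomitant T T \<xi> \<eta> \<zeta> x"
    by (simp add: concomitant_def concomitant_term_def ds)
  also have "T \<in> bundle_maps"
    unfolding T_def by (intro Pi_I sections_add maps[THEN funcset_mem])
  then have "concomitant T T \<xi> \<eta> \<zeta> x = concomitant ?p T \<xi> \<eta> \<zeta> x + concomitant ?q T \<xi> \<eta> \<zeta> x"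
    using concomitant_add[OF ds maps, of T x] by (simp add: T_def)
  also have "concomitant ?p T \<xi> \<eta> \<zeta> x = concomitant T ?p \<xi> \<eta> \<zeta> x"
    by (rule concomitant_commute)
  also have "\<dots> = concomitant ?p ?p \<xi> \<eta> \<zeta> x + concomitant ?q ?p \<xi> \<eta> \<zeta> x"
    unfolding T_def by (rule concomitant_add[OF ds maps maps(1)])
  also have "concomitant ?q ?p \<xi> \<eta> \<zeta> x = concomitant ?p ?q \<xi> \<eta> \<zeta> x"
    by (rule concomitant_commute)
  also have "concomitant ?q T \<xi> \<eta> \<zeta> x = concomitant T ?q \<xi> \<eta> \<zeta> x"
    by (rule concomitant_commute)
  also have "\<dots> = concomitant ?p ?q \<xi> \<eta> \<zeta> x + concomitant ?q ?q \<xi> \<eta> \<zeta> x"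
    unfolding T_def by (rule concomitant_add[OF ds maps maps(2)])
  finally show ?thesis by simp
qed

proposition hamiltonian_imp_poisson_pair:
  assumes "hamiltonian_pair A P P'"
  shows "poisson_pair A P P'"
proof -
  let ?N = "pair_relation A P P'" and ?p = "sharp_section A P" and ?q = "sharp_section A P'"
  have poisson: "poisson_bivector A P" "poisson_bivector A P'"
      "poisson_bivector A (\<lambda>x \<xi> \<eta>. P x \<xi> \<eta> + P' x \<xi> \<eta>)"
    using assms by (simp_all add: hamiltonian_pair_def)
  have biv: "P \<in> bivectors A" "P' \<in> bivectors A" using poisson by (simp_all add: poisson_bivector_def)
  have mixed: "concomitant ?p ?q \<xi> \<eta> \<zeta> x = 0"
    if ds: "\<xi> \<in> dual_sections A" "\<eta> \<in> dual_sections A" "\<zeta> \<in> dual_sections A" for \<xi> \<eta> \<zeta> x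
    using concomitant_bivector_sum[OF biv ds, of x] poisson[THEN poisson_concomitant, OF ds, of x] by simp
  have "nijenhuis_relation A ?N"
    unfolding nijenhuis_relation_def
  proof (intro conjI pair_relation_sections biv allI impI)
    fix u1 v1 u2 v2 \<alpha> \<alpha>' \<alpha>'' x
    assume uv: "(u1, v1) \<in> ?N" "(u2, v2) \<in> ?N"
      and chain: "(\<alpha>, \<alpha>') \<in> dual_relation A ?N" "(\<alpha>', \<alpha>'') \<in> dual_relation A ?N"
    obtain \<xi> \<eta> where \<xi>: "\<xi> \<in> dual_sections A" "u1 = ?q \<xi>" "v1 = ?p \<xi>"
      and \<eta>: "\<eta> \<in> dual_sections A" "u2 = ?q \<eta>" "v2 = ?p \<eta>"
      using uv unfolding pair_relation_def by blast
    have "\<alpha>' \<in> dual_sections A" using chain(1) by (simp add: dual_relation_def)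
    then show "\<alpha> x (bracket A v1 v2 x) - \<alpha>' x (bracket A v1 u2 x + bracket A u1 v2 x)
             + \<alpha>'' x (bracket A u1 u2 x) = 0"
      unfolding \<xi> \<eta> pair_torsion[OF poisson(1,2) \<xi>(1) \<eta>(1) chain]
      using mixed[OF \<xi>(1) \<eta>(1)] by simp
  qed
  then show ?thesis using poisson by (simp add: poisson_pair_def)
qed

end

section \<open>Smoothness of determinants and adjugates\<close>

context smooth_manifold
begin

lemma smooth_det:
  assumes W: "open W" and f: "\<And>i j. i < n \<Longrightarrow> j < n \<Longrightarrow> smooth W (f i j)"
  shows "smooth W (\<lambda>y. Determinant.det (Matrix.mat n n (\<lambda>(i, j). f i j y)))"
proof -
  have "smooth W (\<lambda>y. \<Sum>p\<in>{p. p permutes {0..<n}}. signof p * (\<Prod>i=0..<n. f i (p i) y))"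
    using permutes_in_image by (intro smooth_sum smooth_mult smooth_prod smooth_const W f) fastforce+
  then show ?thesis
  proof (rule smooth_cong[OF W, rotated])
    fix y
    have "Matrix.mat n n (\<lambda>(i, j). f i j y) $$ (i, p i) = f i (p i) y" if "p permutes {0..<n}" "i < n" for p i
      using that permutes_in_image[OF that(1), of i] by simp
    then show "(\<Sum>p\<in>{p. p permutes {0..<n}}. signof p * (\<Prod>i=0..<n. f i (p i) y))
        = Determinant.det (Matrix.mat n n (\<lambda>(i, j). f i j y))"
      by (subst det_def'[of _ n]) (auto intro!: sum.cong)
  qed
qed

lemma smooth_adj_mat:
  assumes W: "open W" and f: "\<And>i j. i < n \<Longrightarrow> j < n \<Longrightarrow> smooth W (f i j)"
    and ij: "i < n" "j < n"
  shows "smooth W (\<lambda>y. adj_mat (Matrix.mat n n (\<lambda>(i, j). f i j y)) $$ (i, j))"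
proof -
  \<comment> \<open>The adjugate transposes: its entry \<open>(i, j)\<close> is the cofactor at
    \<open>(j, i)\<close>, so row \<open>j\<close> and column \<open>i\<close> are skipped.\<close>
  let ?g = "\<lambda>i' j'. f (if i' < j then i' else Suc i') (if j' < i then j' else Suc j')"
  have "smooth W (\<lambda>y. (- 1) ^ (j + i) * Determinant.det (Matrix.mat (n - 1) (n - 1) (\<lambda>(i', j'). ?g i' j' y)))"
    by (intro smooth_mult smooth_const smooth_det W f) auto
  then show ?thesis
  proof (rule smooth_cong[OF W, rotated])
    fix y
    have "mat_delete (Matrix.mat n n (\<lambda>(i, j). f i j y)) j i = Matrix.mat (n - 1) (n - 1) (\<lambda>(i', j'). ?g i' j' y)"
      by (rule eq_matI) (auto simp: mat_delete_def)
    then show "(- 1) ^ (j + i) * Determinant.det (Matrix.mat (n - 1) (n - 1) (\<lambda>(i', j'). ?g i' j' y))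
        = adj_mat (Matrix.mat n n (\<lambda>(i, j). f i j y)) $$ (i, j)"
      using ij by (simp add: adj_mat_def cofactor_def)
  qed
qed

end

context smooth_bundle
begin

text \<open>The adjugate is polynomial in the entries of the matrix of \<open>P\<close>, and its
  defining identity holds at every \<open>y\<close>; injectivity at \<open>x\<close> is used only
  for \<open>d x \<noteq> 0\<close>. Returning plain functions \<open>B\<close>, \<open>d\<close>
  keeps matrices out of the later argument.\<close>

lemma smooth_adjugate:
  assumes P: "P \<in> bivectors A" and e: "(U, e) \<in> frames A" "x \<in> U"
    and inj: "inj_on (sharp A P x) (dual_fibre A x)"
  shows "\<exists>B d. (\<forall>i<bundle_rank A. \<forall>j<bundle_rank A. smooth U (B i j)) \<and> smooth U d \<and> d x \<noteq> 0 \<and>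
    (\<forall>y. \<forall>i<bundle_rank A. \<forall>j<bundle_rank A.
      (\<Sum>k<bundle_rank A. P y (coframe A e i y) (coframe A e k y) * B k j y) = (if i = j then d y else 0))"
proof -
  let ?n = "bundle_rank A"
  define f where "f i j y = P y (coframe A e i y) (coframe A e j y)" for i j y
  define M where "M y = Matrix.mat ?n ?n (\<lambda>(i, j). f i j y)" for y
  have M: "M y \<in> carrier_mat ?n ?n" for y by (simp add: M_def)
  have f: "smooth U (f i j)" if "i < ?n" "j < ?n" for i j
    unfolding f_def by (rule bivector_smooth[OF P e(1) that])
  show ?thesis
  proof (intro exI[of _ "\<lambda>i j y. adj_mat (M y) $$ (i, j)"] exI[of _ "\<lambda>y. Determinant.det (M y)"] conjI allI impI)
    show "smooth U (\<lambda>y. adj_mat (M y) $$ (i, j))" if "i < ?n" "j < ?n" for i j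
      unfolding M_def by (rule smooth_adj_mat[OF open_frame[OF e(1)] f that])
    show "smooth U (\<lambda>y. Determinant.det (M y))"
      unfolding M_def by (rule smooth_det[OF open_frame[OF e(1)] f])
    show "Determinant.det (M x) \<noteq> 0"
    proof
      assume "Determinant.det (M x) = 0"
      then obtain v where v: "v \<in> carrier_vec ?n" "v \<noteq> 0\<^sub>v ?n" "M x *\<^sub>v v = 0\<^sub>v ?n"
        using det_0_iff_vec_prod_zero[OF M] by blast
      \<comment> \<open>The covector with coordinates \<open>v\<close>: a kernel vector of the
        matrix becomes a covector with the same image as 0, and evaluating it on the frame recovers
        \<open>v\<close>.\<close>
      define \<xi> where "\<xi> = (\<lambda>u. \<Sum>j<?n. v $ j * coframe A e j x u)"
      have \<xi>: "\<xi> \<in> dual_fibre A x" unfolding \<xi>_def by (intro sum_mem_dual_fibre coframe_mem[OF e])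
      have "P x (coframe A e i x) \<xi> = 0" if "i < ?n" for i
      proof -
        have "(M x *\<^sub>v v) $ i = 0" using v(3) that by simp
        then have "(\<Sum>j<?n. v $ j * f i j x) = 0"
          using that v(1) by (simp add: M_def scalar_prod_def lessThan_atLeast0 mult.commute)
        then show ?thesis
          unfolding \<xi>_def by (subst bivector_sum[OF P coframe_mem[OF e] coframe_mem[OF e]]) (simp add: f_def)
      qed
      then have "P x \<xi> \<eta> = 0" if \<eta>: "\<eta> \<in> dual_fibre A x" for \<eta>
        using bivector_skew[OF P \<xi> coframe_mem[OF e]]
        by (subst bivector_expansion[OF P e \<xi> \<eta>]) simp
      moreover have "P x (\<lambda>u. 0) \<eta> = 0" if \<eta>: "\<eta> \<in> dual_fibre A x" for \<eta>
        using bivector_skew[OF P zero_mem_dual_fibre \<eta>] bivector_zero[OF P \<eta>] by simp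
      ultimately have "sharp A P x \<xi> = sharp A P x (\<lambda>u. 0)"
        by (intro fibre_eqI[of _ x] sharp_fibre[OF P] \<xi> zero_mem_dual_fibre)
          (simp add: sharp_pairing[OF P] \<xi> zero_mem_dual_fibre)
      then have "\<xi> = (\<lambda>u. 0)" using inj_onD[OF inj _ \<xi> zero_mem_dual_fibre] by blast
      moreover have "\<xi> (e i x) = v $ i" if "i < ?n" for i
      proof -
        have "\<xi> (e i x) = (\<Sum>j<?n. if j = i then v $ j else 0)"
          unfolding \<xi>_def using that by (intro sum.cong) (simp_all add: coframe_frame[OF e])
        then show ?thesis using that by simp
      qed
      ultimately have "v $ i = 0" if "i < ?n" for i using that by simp
      then show False using v(1,2) by (metis eq_vecI carrier_vecD index_zero_vec)
    qed
    show "(\<Sum>k<?n. P y (coframe A e i y) (coframe A e k y) * adj_mat (M y) $$ (k, j))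
        = (if i = j then Determinant.det (M y) else 0)" if "i < ?n" "j < ?n" for y i j
    proof -
      note adj = adj_mat(1,2)[OF M[of y]]
      have "(M y * adj_mat (M y)) $$ (i, j) = (if i = j then Determinant.det (M y) else 0)"
        unfolding adj(2) using that by simp
      moreover have "(M y * adj_mat (M y)) $$ (i, j) = (\<Sum>k<?n. M y $$ (i, k) * adj_mat (M y) $$ (k, j))"
        using that M[of y] adj(1) by (simp add: scalar_prod_def lessThan_atLeast0)
      ultimately show ?thesis using that by (simp add: M_def f_def)
    qed
  qed
qed

text \<open>Reduces an equation between bivector values to one between matrix-vector products, with
  the cut-off \<open>t\<close> as a common factor.\<close>

lemma bivector_local_dual_section:
  assumes P: "P \<in> bivectors A" and e: "(U, e) \<in> frames A" "y \<in> U" and \<eta>: "\<eta> \<in> dual_fibre A y"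
  shows "P y \<eta> (\<lambda>u. \<Sum>j<bundle_rank A. (t * a j) * coframe A e j y u)
    = t * (\<Sum>i<bundle_rank A. \<eta> (e i y) *
        (\<Sum>j<bundle_rank A. P y (coframe A e i y) (coframe A e j y) * a j))"
proof -
  let ?n = "bundle_rank A" and ?m = "\<lambda>i j. P y (coframe A e i y) (coframe A e j y)"
  have "P y \<eta> (coframe A e j y) = (\<Sum>i<?n. \<eta> (e i y) * ?m i j)" for j
  proof -
    have "P y \<eta> (coframe A e j y) = - (\<Sum>i<?n. \<eta> (e i y) * ?m j i)"
      unfolding bivector_expansion[OF P e coframe_mem[OF e] \<eta>, symmetric]
      by (rule bivector_skew[OF P \<eta> coframe_mem[OF e]])
    also have "\<dots> = (\<Sum>i<?n. \<eta> (e i y) * - ?m j i)" by (simp add: sum_negf)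
    also have "\<dots> = (\<Sum>i<?n. \<eta> (e i y) * ?m i j)"
    proof (intro sum.cong refl)
      fix i
      have "?m i j = - ?m j i" by (rule bivector_skew[OF P coframe_mem[OF e] coframe_mem[OF e]])
      then show "\<eta> (e i y) * - ?m j i = \<eta> (e i y) * ?m i j" by (simp only:)
    qed
    finally show ?thesis .
  qed
  then have "P y \<eta> (\<lambda>u. \<Sum>j<?n. (t * a j) * coframe A e j y u)
      = (\<Sum>j<?n. (t * a j) * (\<Sum>i<?n. \<eta> (e i y) * ?m i j))"
    by (subst bivector_sum[OF P \<eta> coframe_mem[OF e]]) simp
  also have "\<dots> = (\<Sum>j<?n. \<Sum>i<?n. t * (\<eta> (e i y) * (?m i j * a j)))"
    by (simp add: sum_distrib_left mult_ac)
  also have "\<dots> = (\<Sum>i<?n. \<Sum>j<?n. t * (\<eta> (e i y) * (?m i j * a j)))" by (rule sum.swap)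
  finally show ?thesis by (simp add: sum_distrib_left)
qed

end

context smooth_algebroid
begin

text \<open>With matrices \<open>M\<close>, \<open>M'\<close> of \<open>P\<close>, \<open>P'\<close> in a frame, adjugates \<open>B\<close>, \<open>B'\<close> and determinants
  \<open>d\<close>, \<open>d'\<close>, the chain is given near \<open>x\<close> by \<open>\<alpha> = B d' M' k\<close>, \<open>\<alpha>' = d d' k\<close>, \<open>\<alpha>'' = B' d M k\<close> for a
  constant vector \<open>k\<close>. This solves \<open>P \<alpha> = P' \<alpha>'\<close> and \<open>P \<alpha>' = P' \<alpha>''\<close> without any division.\<close>

lemma chain_through:
  assumes P: "P \<in> bivectors A" and P': "P' \<in> bivectors A"
    and nd: "nondegenerate A P" "nondegenerate A P'" and c: "c \<in> dual_fibre A x"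
  obtains \<alpha> \<alpha>' \<alpha>'' where "\<alpha>' x = c" "(\<alpha>, \<alpha>') \<in> dual_relation A (pair_relation A P P')"
    "(\<alpha>', \<alpha>'') \<in> dual_relation A (pair_relation A P P')"
proof -
  let ?n = "bundle_rank A"
  obtain U e where e: "(U, e) \<in> frames A" "x \<in> U" by (rule frame_exists)
  note op = open_frame[OF e(1)]
  obtain \<theta> V K where \<theta>: "smooth UNIV \<theta>" "open V" "x \<in> V" "\<And>y. y \<in> V \<Longrightarrow> \<theta> y = 1"
    "closed K" "K \<subseteq> U" "\<And>y. y \<notin> K \<Longrightarrow> \<theta> y = 0"
    by (rule bump_function[OF op e(2)]) blast
  have inj: "inj_on (sharp A P x) (dual_fibre A x)" "inj_on (sharp A P' x) (dual_fibre A x)"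
    using nd by (simp_all add: nondegenerate_def bij_betw_def)
  define m where "m i j y = P y (coframe A e i y) (coframe A e j y)" for i j y
  define m' where "m' i j y = P' y (coframe A e i y) (coframe A e j y)" for i j y
  have sm: "smooth U (m i j)" "smooth U (m' i j)" if "i < ?n" "j < ?n" for i j
    unfolding m_def m'_def by (rule bivector_smooth[OF P e(1) that], rule bivector_smooth[OF P' e(1) that])
  obtain B d where B: "\<forall>i<?n. \<forall>j<?n. smooth U (B i j)" "smooth U d" "d x \<noteq> 0"
    "\<forall>y. \<forall>i<?n. \<forall>j<?n. (\<Sum>k<?n. m i k y * B k j y) = (if i = j then d y else 0)"
    using smooth_adjugate[OF P e inj(1)] unfolding m_def by (elim exE conjE)
  obtain B' d' where B': "\<forall>i<?n. \<forall>j<?n. smooth U (B' i j)" "smooth U d'" "d' x \<noteq> 0"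
    "\<forall>y. \<forall>i<?n. \<forall>j<?n. (\<Sum>k<?n. m' i k y * B' k j y) = (if i = j then d' y else 0)"
    using smooth_adjugate[OF P' e inj(2)] unfolding m'_def by (elim exE conjE)
  \<comment> \<open>Only the determinants at the single point \<open>x\<close> are inverted. These
    constants normalise the middle section to the value \<open>c\<close> at
    \<open>x\<close>.\<close>
  define k where "k i = c (e i x) / (d x * d' x)" for i
  define w where "w i y = (\<Sum>l<?n. m i l y * k l)" for i y
  define w' where "w' i y = (\<Sum>l<?n. m' i l y * k l)" for i y
  define a where "a i y = (\<Sum>j<?n. B i j y * (d' y * w' j y))" for i y
  define a' where "a' i y = d y * d' y * k i" for i y
  define a'' where "a'' i y = (\<Sum>j<?n. B' i j y * (d y * w j y))" for i y
  have sw: "smooth U (w i)" "smooth U (w' i)" if "i < ?n" for i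
    unfolding w_def w'_def using that by (intro smooth_sum smooth_mult smooth_const op sm; simp)+
  have sa: "smooth U (a i)" "smooth U (a' i)" "smooth U (a'' i)" if "i < ?n" for i
    unfolding a_def a'_def a''_def using that
    by (intro smooth_sum smooth_mult smooth_const op sm sw B(2) B'(2) B(1)[rule_format] B'(1)[rule_format]; simp)+
  \<comment> \<open>Associativity: \<open>q\<close> will be row \<open>i\<close> of a matrix and
    \<open>R\<close> its adjugate, so the row \<open>q R\<close> has the determinant
    \<open>D\<close> at position \<open>i\<close> and 0 elsewhere.\<close>
  have contract: "(\<Sum>j<?n. q j * (\<Sum>l<?n. R j l * h l)) = D * h i"
    if "i < ?n" "\<And>l. l < ?n \<Longrightarrow> (\<Sum>j<?n. q j * R j l) = (if i = l then D else 0)"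
    for q h :: "nat \<Rightarrow> real" and R D i
  proof -
    have "(\<Sum>j<?n. q j * (\<Sum>l<?n. R j l * h l)) = (\<Sum>j<?n. \<Sum>l<?n. q j * R j l * h l)"
      by (simp add: sum_distrib_left mult.assoc)
    also have "\<dots> = (\<Sum>l<?n. \<Sum>j<?n. q j * R j l * h l)" by (rule sum.swap)
    also have "\<dots> = (\<Sum>l<?n. (if i = l then D else 0) * h l)"
      by (intro sum.cong) (simp_all add: that(2) sum_distrib_right[symmetric])
    also have "\<dots> = (\<Sum>l<?n. if i = l then D * h l else 0)"
      by (intro sum.cong) auto
    also have "\<dots> = D * h i" using that(1) by simp
    finally show ?thesis .
  qed
  have eq1: "(\<Sum>j<?n. m i j y * a j y) = (\<Sum>j<?n. m' i j y * a' j y)" if "i < ?n" for i y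
  proof -
    have "(\<Sum>j<?n. m i j y * a j y) = d y * (d' y * w' i y)"
      unfolding a_def by (rule contract[OF that]) (use B(4) that in simp)
    also have "\<dots> = (\<Sum>j<?n. m' i j y * a' j y)"
      by (simp add: w'_def a'_def sum_distrib_left mult_ac)
    finally show ?thesis .
  qed
  have eq2: "(\<Sum>j<?n. m' i j y * a'' j y) = (\<Sum>j<?n. m i j y * a' j y)" if "i < ?n" for i y
  proof -
    have "(\<Sum>j<?n. m' i j y * a'' j y) = d' y * (d y * w i y)"
      unfolding a''_def by (rule contract[OF that]) (use B'(4) that in simp)
    also have "\<dots> = (\<Sum>j<?n. m i j y * a' j y)"
      by (simp add: w_def a'_def sum_distrib_left mult_ac)
    finally show ?thesis .
  qed
  \<comment> \<open>All three sections get the same cut-off. The chain equations are linear, so they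
    survive multiplication by \<open>\<theta>\<close> and hold trivially off
    \<open>K\<close>.\<close>
  define sec where "sec a = (\<lambda>y u. \<Sum>i<?n. (\<theta> y * a i y) * coframe A e i y u)" for a :: "nat \<Rightarrow> 'm \<Rightarrow> real"
  have sec: "sec h \<in> dual_sections A" if "\<And>i. i < ?n \<Longrightarrow> smooth U (h i)" for h
    unfolding sec_def by (rule local_dual_section[OF e(1) that \<theta>(1,5,6,7)])
  have ds: "sec a \<in> dual_sections A" "sec a' \<in> dual_sections A" "sec a'' \<in> dual_sections A"
    using sec[of a] sec[of a'] sec[of a''] sa by simp_all
  have rel: "sec f' y (sharp_section A P' \<xi> y) = sec f y (sharp_section A P \<xi> y)"
    if f: "sec f \<in> dual_sections A" "sec f' \<in> dual_sections A" and \<xi>: "\<xi> \<in> dual_sections A"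
      and eq: "\<And>i y. i < ?n \<Longrightarrow> (\<Sum>j<?n. m i j y * f j y) = (\<Sum>j<?n. m' i j y * f' j y)" for f f' \<xi> y
  proof -
    note \<xi>y = dual_sections_fibre[OF \<xi>, of y]
    have "P y (\<xi> y) (sec f y) = P' y (\<xi> y) (sec f' y)"
    proof (cases "y \<in> K")
      case True
      then have y: "y \<in> U" using \<theta>(6) by blast
      show ?thesis
        unfolding sec_def bivector_local_dual_section[OF P e(1) y \<xi>y] bivector_local_dual_section[OF P' e(1) y \<xi>y]
        using eq by (simp add: m_def m'_def)
    next
      case False
      then show ?thesis by (simp add: sec_def \<theta>(7) bivector_zero[OF P \<xi>y] bivector_zero[OF P' \<xi>y])
    qed
    then show ?thesis by (simp add: sharp_section_pairing P P' f \<xi>)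
  qed
  show thesis
  proof (rule that)
    have "a' i x = c (e i x)" for i using B(3) B'(3) by (simp add: a'_def k_def)
    then show "sec a' x = c"
      using dual_expansion[OF e c] \<theta>(3,4) by (simp add: sec_def)
    show "(sec a, sec a') \<in> dual_relation A (pair_relation A P P')"
      unfolding dual_pair_relation_iff by (intro conjI ballI allI ds rel eq1)
    show "(sec a', sec a'') \<in> dual_relation A (pair_relation A P P')"
      unfolding dual_pair_relation_iff by (intro conjI ballI allI ds rel eq2[symmetric])
  qed
qed

proposition nondegenerate_poisson_pair_imp_hamiltonian:
  assumes "nondegenerate_poisson_pair A P P'"
  shows "hamiltonian_pair A P P'"
proof -
  let ?N = "pair_relation A P P'" and ?p = "sharp_section A P" and ?q = "sharp_section A P'"
  have poisson: "poisson_bivector A P" "poisson_bivector A P'" and nd: "nondegenerate A P" "nondegenerate A P'"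
    and nij: "nijenhuis_relation A ?N"
    using assms by (simp_all add: nondegenerate_poisson_pair_def poisson_pair_def)
  have biv: "P \<in> bivectors A" "P' \<in> bivectors A" using poisson by (simp_all add: poisson_bivector_def)
  have "poisson_bivector A (\<lambda>x \<xi> \<eta>. P x \<xi> \<eta> + P' x \<xi> \<eta>)" (is "poisson_bivector A ?S")
  proof (rule poisson_bivectorI[OF sum_mem_bivectors[OF biv]])
    fix x a b c assume abc: "a \<in> dual_fibre A x" "b \<in> dual_fibre A x" "c \<in> dual_fibre A x"
    obtain \<xi> where \<xi>: "\<xi> \<in> dual_sections A" "\<xi> x = a" by (rule dual_section_through[OF abc(1)])
    obtain \<eta> where \<eta>: "\<eta> \<in> dual_sections A" "\<eta> x = b" by (rule dual_section_through[OF abc(2)])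
    obtain \<alpha> \<alpha>' \<alpha>'' where \<alpha>: "\<alpha>' x = c" "(\<alpha>, \<alpha>') \<in> dual_relation A ?N" "(\<alpha>', \<alpha>'') \<in> dual_relation A ?N"
      by (rule chain_through[OF biv nd abc(3)])
    have \<alpha>': "\<alpha>' \<in> dual_sections A" using \<alpha>(2) by (simp add: dual_relation_def)
    have N: "(?q \<xi>, ?p \<xi>) \<in> ?N" "(?q \<eta>, ?p \<eta>) \<in> ?N" using \<xi>(1) \<eta>(1) by (auto simp: pair_relation_def)
    have "\<alpha> x (bracket A (?p \<xi>) (?p \<eta>) x)
      - \<alpha>' x (bracket A (?p \<xi>) (?q \<eta>) x + bracket A (?q \<xi>) (?p \<eta>) x)
      + \<alpha>'' x (bracket A (?q \<xi>) (?q \<eta>) x) = 0"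
      using nij N \<alpha>(2,3) unfolding nijenhuis_relation_def by blast
    then have "concomitant ?p ?q \<xi> \<eta> \<alpha>' x = 0"
      unfolding pair_torsion[OF poisson \<xi>(1) \<eta>(1) \<alpha>(2,3)] by simp
    \<comment> \<open>In the polarisation formula the two pure terms vanish as well, since
      \<open>P\<close> and \<open>P'\<close> are Poisson.\<close>
    then have "concomitant (sharp_section A ?S) (sharp_section A ?S) \<xi> \<eta> \<alpha>' x = 0"
      using poisson[THEN poisson_concomitant, OF \<xi>(1) \<eta>(1) \<alpha>']
      by (simp add: concomitant_bivector_sum[OF biv \<xi>(1) \<eta>(1) \<alpha>'])
    then show "\<exists>\<xi>\<in>dual_sections A. \<exists>\<eta>\<in>dual_sections A. \<exists>\<zeta>\<in>dual_sections A.
        \<xi> x = a \<and> \<eta> x = b \<and> \<zeta> x = c \<and>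
        concomitant (sharp_section A ?S) (sharp_section A ?S) \<xi> \<eta> \<zeta> x = 0"
      using \<xi> \<eta> \<alpha>(1) \<alpha>' by blast
  qed
  then show ?thesis using poisson by (simp add: hamiltonian_pair_def)
qed

end

theorem corollary2p7:
  fixes A :: "('m::{t2_space,second_countable_topology}, 'b::real_inner, 'e::real_vector) lie_algebroid"
    and \<pi> \<pi>' :: "('m, 'e) bivector_field"
  assumes "is_lie_algebroid A"
  shows "(hamiltonian_pair A \<pi> \<pi>' \<longrightarrow> poisson_pair A \<pi> \<pi>') \<and>
    (nondegenerate_poisson_pair A \<pi> \<pi>' \<longrightarrow> hamiltonian_pair A \<pi> \<pi>')"
proof -
  interpret smooth_algebroid A using assms by unfold_locales
  show ?thesis
    using hamiltonian_imp_poisson_pair nondegenerate_poisson_pair_imp_hamiltonian by blast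
qed

end
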